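(* Fix $\sigma>0$ and a continuous $a:[0,1]\to\mathbb{R}$. There exists $H_c\in(\tfrac12,1)$ such that for every $H\in(H_c,1)$, $$P(|\mathcal{Y}^H_n|>g_n^H\ \text{i.o.})=1,$$ and for every $H\in(\tfrac12,H_c)$, $$P(|\mathcal{Y}^H_n|>g_n^H\ \text{ult.})=0.$$ In particular, if $H\in(H_c,1)$ then $\lim_{N\to\infty}\frac{|\mathcal{A}_\mathcal{P}^{(N,H)}|}{2^{N-1}}=1$.
   Context: For $H\in(\frac12,1)$ let $c_H=\sqrt{\frac{2H\,\Gamma(\frac32-H)}{\Gamma(H+\frac12)\Gamma(2-2H)}}$ and $C_H=c_H(H-\frac12)$. For integers $1\le i<n$ let $j_n^H(i)=\sigma C_H\int_{i-1}^i x^{\frac12-H}\Big(\int_0^1(v+n-1)^{H-\frac12}(v+n-1-x)^{H-\frac32}dv\Big)dx$, and for $n\ge1$ let $g_n^H=\sigma C_H\int_{n-1}^n x^{\frac12-H}(n-x)^{H-\frac12}\Big(\int_0^1(y(n-x)+x)^{H-\frac12}y^{H-\frac32}dy\Big)dx$. Let $(\xi_i)_{i\ge1}$ be i.i.d. with $P(\xi_i=1)=P(\xi_i=-1)=\frac12$, and $\mathcal{Y}_n^H=\sum_{i=1}^{n-1}j_n^H(i)\xi_i$ ($\mathcal{Y}_1^H=0$). For events $A_n$, $\{A_n\ \text{i.o.}\}=\bigcap_{n\ge1}\bigcup_{k\ge n}A_k$ and $\{A_n\ \text{ult.}\}=\bigcup_{n\ge1}\bigcap_{k\ge n}A_k$.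 Market objects: $k_H(t,s)=C_H s^{\frac12-H}\int_s^t u^{H-\frac12}(u-s)^{H-\frac32}du$; for $N>1$, $1\le i<n\le N$: $J_n^{(N,H)}(i)=\sigma\sqrt N\int_{(i-1)/N}^{i/N}(k_H(\frac nN,u)-k_H(\frac{n-1}N,u))du$; $g_n^{(N,H)}=\sigma\sqrt N\int_{(n-1)/N}^{n/N}k_H(\frac nN,u)du$; $a_n^{(N)}=\frac1Na(n/N)$; for $x\in\{-1,1\}^{n-1}$, $Y_n^{(N,H)}(x)=\sum_{i=1}^{n-1}J_n^{(N,H)}(i)x_i$ ($Y_1^{(N,H)}=0$), $u_n^{(N)}(x)=Y_n^{(N,H)}(x)+g_n^{(N,H)}$, $d_n^{(N)}(x)=Y_n^{(N,H)}(x)-g_n^{(N,H)}$. For $n\ge2$, $\mathcal{A}_n^{(N,H)}=\{x\in\{-1,1\}^{n-1}:u_n^{(N)}(x)\le-a_n^{(N)}\text{ or }d_n^{(N)}(x)\ge-a_n^{(N)}\}$; $\mathcal{A}_1^{(N,H)}$ is the one-element set containing the empty sequence if $u_1^{(N)}\le-a_1^{(N)}$ or $d_1^{(N)}\ge-a_1^{(N)}$, and $\emptyset$ otherwise. The set of arbitrage paths is $\mathcal{A}_\mathcal{P}^{(N,H)}=\{(x_1,\dots,x_{N-1})\in\{-1,1\}^{N-1}:\exists n\in\{1,\dots,N\},\ (x_1,\dots,x_{n-1})\in\mathcal{A}_n^{(N,H)}\}$. *)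

theory Defs
  imports "HOL-Analysis.Analysis" "HOL-Probability.Probability"
begin

definition cH :: "real \<Rightarrow> real" where
  "cH H = sqrt (2 * H * Gamma (3/2 - H) / (Gamma (H + 1/2) * Gamma (2 - 2*H)))"

definition CH :: "real \<Rightarrow> real" where
  "CH H = cH H * (H - 1/2)"

definition jH :: "real \<Rightarrow> real \<Rightarrow> nat \<Rightarrow> nat \<Rightarrow> real" where
  "jH \<sigma> H n i = \<sigma> * CH H * integral {real i - 1 .. real i}
     (\<lambda>x. x powr (1/2 - H) *
        integral {0..1} (\<lambda>v. (v + real n - 1) powr (H - 1/2) * (v + real n - 1 - x) powr (H - 3/2)))"

definition gH :: "real \<Rightarrow> real \<Rightarrow> nat \<Rightarrow> real" where
  "gH \<sigma> H n = \<sigma> * CH H * integral {real n - 1 .. real n}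
     (\<lambda>x. x powr (1/2 - H) * (real n - x) powr (H - 1/2) *
        integral {0..1} (\<lambda>y. (y * (real n - x) + x) powr (H - 1/2) * y powr (H - 3/2)))"

text \<open>Probability space carrying the i.i.d. symmetric signs: xi_i(omega) = omega i (i >= 1).\<close>
definition Rad :: "(nat \<Rightarrow> real) measure" where
  "Rad = PiM UNIV (\<lambda>_. measure_pmf (pmf_of_set {-1, 1}))"

definition YH :: "real \<Rightarrow> real \<Rightarrow> nat \<Rightarrow> (nat \<Rightarrow> real) \<Rightarrow> real" where
  "YH \<sigma> H n \<omega> = (\<Sum>i = 1..n - 1. jH \<sigma> H n i * \<omega> i)"

definition kH :: "real \<Rightarrow> real \<Rightarrow> real \<Rightarrow> real" where
  "kH H t s = CH H * s powr (1/2 - H) *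
     integral {s..t} (\<lambda>u. u powr (H - 1/2) * (u - s) powr (H - 3/2))"

definition JN :: "real \<Rightarrow> real \<Rightarrow> nat \<Rightarrow> nat \<Rightarrow> nat \<Rightarrow> real" where
  "JN \<sigma> H N n i = \<sigma> * sqrt (real N) * integral {(real i - 1) / real N .. real i / real N}
     (\<lambda>u. kH H (real n / real N) u - kH H ((real n - 1) / real N) u)"

definition gN :: "real \<Rightarrow> real \<Rightarrow> nat \<Rightarrow> nat \<Rightarrow> real" where
  "gN \<sigma> H N n = \<sigma> * sqrt (real N) * integral {(real n - 1) / real N .. real n / real N}
     (\<lambda>u. kH H (real n / real N) u)"

definition aN :: "(real \<Rightarrow> real) \<Rightarrow> nat \<Rightarrow> nat \<Rightarrow> real" where
  "aN a N n = a (real n / real N) / real N"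

text \<open>Paths x in {-1,1}^(n-1) are lists of length n-1; x_i = x ! (i-1).\<close>
definition YN :: "real \<Rightarrow> real \<Rightarrow> nat \<Rightarrow> nat \<Rightarrow> real list \<Rightarrow> real" where
  "YN \<sigma> H N n x = (\<Sum>i = 1..n - 1. JN \<sigma> H N n i * x ! (i - 1))"

definition uN :: "real \<Rightarrow> real \<Rightarrow> nat \<Rightarrow> nat \<Rightarrow> real list \<Rightarrow> real" where
  "uN \<sigma> H N n x = YN \<sigma> H N n x + gN \<sigma> H N n"

definition dN :: "real \<Rightarrow> real \<Rightarrow> nat \<Rightarrow> nat \<Rightarrow> real list \<Rightarrow> real" where
  "dN \<sigma> H N n x = YN \<sigma> H N n x - gN \<sigma> H N n"

text \<open>For n = 1 this is {[]} or {} according to the condition, as in the paper.\<close>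
definition An :: "real \<Rightarrow> (real \<Rightarrow> real) \<Rightarrow> real \<Rightarrow> nat \<Rightarrow> nat \<Rightarrow> real list set" where
  "An \<sigma> a H N n = {x. length x = n - 1 \<and> set x \<subseteq> {-1, 1} \<and>
      (uN \<sigma> H N n x \<le> - aN a N n \<or> dN \<sigma> H N n x \<ge> - aN a N n)}"

definition AP :: "real \<Rightarrow> (real \<Rightarrow> real) \<Rightarrow> real \<Rightarrow> nat \<Rightarrow> real list set" where
  "AP \<sigma> a H N = {x. length x = N - 1 \<and> set x \<subseteq> {-1, 1} \<and>
      (\<exists>n\<in>{1..N}. take (n - 1) x \<in> An \<sigma> a H N n)}"

end

theory Submission
  imports Defs
begin

text \<open>
  Any threshold works; we take \<open>Hc = 5/8\<close>. Put \<open>\<beta> = H - 1/2\<close>. The coefficient \<open>jH \<sigma> H n (n - k)\<close> is at least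
  a multiple of \<open>(k + 1) powr (\<beta> - 1)\<close> uniformly in \<open>n\<close>, and \<open>gH \<sigma> H n\<close> is bounded in \<open>n\<close>. Hence
  for a fixed large \<open>K\<close> every prefix of signs can be continued by \<open>K\<close> equal signs (those of the current
  partial sum) so that \<open>\<bar>YH\<bar>\<close> exceeds \<open>gH + 1\<close>: given the past, this has probability at least
  \<open>1 / 2 ^ K\<close>, so it happens infinitely often almost surely.

  Conversely, for \<open>\<beta> \<le> 1/8\<close> the second moments of \<open>YH\<close> are bounded and the coefficients close to the
  diagonal are at most \<open>gH\<close>. By Chebyshev's inequality the contribution of all but the last \<open>K\<close> signs is
  bounded with probability at least 1/2, even conditionally on any fixed finite prefix, and choosing the
  last \<open>K\<close> signs greedily against the current sum brings \<open>\<bar>YH\<bar>\<close> below \<open>gH\<close>.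

  The market quantities are \<open>N powr (- H)\<close> times their scale-free versions, whereas the drift is of order
  \<open>1 / N\<close>, so that \<open>\<bar>YH\<bar> \<ge> gH + 1\<close> produces an arbitrage point as soon as \<open>N\<close> is large.
\<close>

section \<open>Weighted sums of finite sign sequences\<close>

definition signs :: "nat \<Rightarrow> real list set" where
  "signs n = {x. length x = n \<and> set x \<subseteq> {-1, 1}}"

definition wsum :: "(nat \<Rightarrow> real) \<Rightarrow> real list \<Rightarrow> real" where
  "wsum b x = (\<Sum>i<length x. b i * x ! i)"

lemma finite_signs [simp]: "finite (signs n)"
  using finite_lists_length_eq[of "{-1, 1::real}" n] by (simp add: signs_def conj_commute)

lemma card_signs: "card (signs n) = 2 ^ n"
  using card_lists_length_eq[of "{-1, 1::real}" n] by (simp add: signs_def conj_commute card_insert_if numeral_2_eq_2)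

lemma signs_0 [simp]: "signs 0 = {[]}"
  by (auto simp: signs_def)

lemma signs_Suc: "signs (Suc n) = (\<lambda>y. 1 # y) ` signs n \<union> (\<lambda>y. -1 # y) ` signs n"
  by (auto simp: signs_def length_Suc_conv image_iff)

lemma append_in_signs: "s \<in> signs m \<Longrightarrow> y \<in> signs k \<Longrightarrow> s @ y \<in> signs (m + k)"
  by (auto simp: signs_def)

lemma take_drop_in_signs:
  assumes "x \<in> signs (m + k)"
  shows "take m x \<in> signs m" "drop m x \<in> signs k"
  using assms set_take_subset[of m x] set_drop_subset[of m x] by (auto simp: signs_def)

lemma length_signs: "x \<in> signs n \<Longrightarrow> length x = n"
  by (simp add: signs_def)

lemma signs_nth: "x \<in> signs n \<Longrightarrow> i < n \<Longrightarrow> x ! i = -1 \<or> x ! i = 1"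
  using nth_mem[of i x] unfolding signs_def by blast

lemma sum_signs_Suc:
  "(\<Sum>y\<in>signs (Suc n). f y) = (\<Sum>y\<in>signs n. f (1 # y) + f (-1 # y))" for f :: "real list \<Rightarrow> real"
proof -
  have "(\<Sum>y\<in>signs (Suc n). f y) =
      (\<Sum>y\<in>(\<lambda>y. 1 # y) ` signs n. f y) + (\<Sum>y\<in>(\<lambda>y. -1 # y) ` signs n. f y)"
    unfolding signs_Suc by (rule sum.union_disjoint) auto
  also have "\<dots> = (\<Sum>y\<in>signs n. f (1 # y) + f (-1 # y))"
    by (simp add: sum.reindex inj_on_def sum.distrib)
  finally show ?thesis .
qed

lemma wsum_Nil [simp]: "wsum b [] = 0"
  by (simp add: wsum_def)

lemma wsum_Cons [simp]: "wsum b (e # y) = b 0 * e + wsum (\<lambda>i. b (Suc i)) y"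
  by (simp add: wsum_def sum.lessThan_Suc_shift del: sum.lessThan_Suc)

lemma wsum_append: "wsum b (s @ y) = wsum b s + wsum (\<lambda>i. b (length s + i)) y"
  by (induction s arbitrary: b) simp_all

lemma wsum_replicate: "wsum b (replicate k e) = (\<Sum>i<k. b i) * e"
  by (simp add: wsum_def sum_distrib_right)

lemma abs_wsum_le:
  assumes "x \<in> signs n" "\<And>i. i < n \<Longrightarrow> 0 \<le> b i"
  shows "\<bar>wsum b x\<bar> \<le> (\<Sum>i<n. b i)"
proof -
  have len: "length x = n" and v: "\<And>i. i < n \<Longrightarrow> \<bar>x ! i\<bar> = 1"
    using length_signs[OF assms(1)] signs_nth[OF assms(1)] by fastforce+
  have "\<bar>wsum b x\<bar> \<le> (\<Sum>i<n. \<bar>b i * x ! i\<bar>)"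
    unfolding wsum_def len by (rule sum_abs)
  also have "\<dots> = (\<Sum>i<n. b i)"
    using v assms(2) by (intro sum.cong) (auto simp: abs_mult)
  finally show ?thesis .
qed

text \<open>Averaging over the first sign cancels the cross term between \<open>c\<close> and
  \<open>b 0\<close>. The free constant \<open>c\<close> carries the induction and later stands for
  the contribution of a fixed prefix.\<close>

lemma wsum_second_moment:
  "(\<Sum>y\<in>signs k. (c + wsum b y)\<^sup>2) = 2 ^ k * (c\<^sup>2 + (\<Sum>i<k. (b i)\<^sup>2))"
proof (induction k arbitrary: b c)
  case 0
  then show ?case by simp
next
  case (Suc k)
  let ?w = "wsum (\<lambda>i. b (Suc i))"
  have "(\<Sum>y\<in>signs (Suc k). (c + wsum b y)\<^sup>2) =
      (\<Sum>y\<in>signs k. ((c + b 0) + ?w y)\<^sup>2) + (\<Sum>y\<in>signs k. ((c - b 0) + ?w y)\<^sup>2)"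
    by (simp add: sum_signs_Suc sum.distrib algebra_simps)
  also have "\<dots> = 2 ^ Suc k * (c\<^sup>2 + ((b 0)\<^sup>2 + (\<Sum>i<k. (b (Suc i))\<^sup>2)))"
    unfolding Suc.IH by (simp add: power2_eq_square algebra_simps)
  finally show ?case
    by (simp add: sum.lessThan_Suc_shift del: sum.lessThan_Suc)
qed

text \<open>Chebyshev's inequality by counting: each bad \<open>y\<close> adds at least the square
  of \<open>C\<close> to the second moment, and the factor 2 in the assumption leaves room for at
  most half of all sign lists.\<close>

lemma wsum_chebyshev:
  assumes "2 * (c\<^sup>2 + (\<Sum>i<k. (b i)\<^sup>2)) \<le> C\<^sup>2" "0 < C"
  shows "2 ^ k / 2 \<le> real (card {y \<in> signs k. \<bar>c + wsum b y\<bar> \<le> C})"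
proof -
  let ?G = "{y \<in> signs k. \<bar>c + wsum b y\<bar> \<le> C}"
  have sq: "C\<^sup>2 \<le> (c + wsum b y)\<^sup>2" if "y \<in> signs k - ?G" for y
    using that assms(2) by (intro power2_le_iff_abs_le[THEN iffD2] abs_le_square_iff[THEN iffD1]) auto
  have "real (card (signs k - ?G)) * C\<^sup>2 \<le> (\<Sum>y\<in>signs k - ?G. (c + wsum b y)\<^sup>2)"
    using sum_mono[of "signs k - ?G" "\<lambda>_. C\<^sup>2", OF sq] by simp
  also have "\<dots> \<le> (\<Sum>y\<in>signs k. (c + wsum b y)\<^sup>2)"
    by (rule sum_mono2) auto
  also have "\<dots> \<le> 2 ^ k / 2 * C\<^sup>2"
    unfolding wsum_second_moment using assms(1) mult_left_mono[OF assms(1), of "2 ^ k / 2"] by simp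
  finally have "real (card (signs k - ?G)) \<le> 2 ^ k / 2"
    using assms(2) by (simp add: mult_le_cancel_right)
  moreover have "real (card (signs k)) = real (card ?G) + real (card (signs k - ?G))"
    using card_Diff_subset[of ?G "signs k"] card_mono[of "signs k" ?G] by auto
  ultimately show ?thesis by (simp add: card_signs)
qed

text \<open>Each sign is chosen against the current sum. The modulus drops by \<open>b i\<close> as
  long as zero is not crossed; a step that crosses zero lands within \<open>G\<close>, because no
  weight exceeds \<open>G\<close>, and the sum never leaves that range again.\<close>

lemma greedy_signs:
  assumes "\<And>i. i < k \<Longrightarrow> 0 \<le> b i \<and> b i \<le> G"
  shows "\<exists>y\<in>signs k. \<bar>c + wsum b y\<bar> \<le> max G (\<bar>c\<bar> - (\<Sum>i<k. b i))"
  using assms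
proof (induction k arbitrary: b c)
  case 0
  then show ?case by simp
next
  case (Suc k)
  define e :: real where "e = (if c \<ge> 0 then -1 else 1)"
  have b0: "0 \<le> b 0" "b 0 \<le> G" using Suc.prems[of 0] by auto
  obtain y where y: "y \<in> signs k"
      "\<bar>(c + b 0 * e) + wsum (\<lambda>i. b (Suc i)) y\<bar> \<le> max G (\<bar>c + b 0 * e\<bar> - (\<Sum>i<k. b (Suc i)))"
    using Suc.IH[of "\<lambda>i. b (Suc i)" "c + b 0 * e"] Suc.prems by auto
  have nn: "0 \<le> (\<Sum>i<k. b (Suc i))"
    using Suc.prems by (intro sum_nonneg) auto
  have "\<bar>c + b 0 * e\<bar> \<le> max G (\<bar>c\<bar> - b 0)"
    using b0 by (auto simp: e_def)
  moreover have "e # y \<in> signs (Suc k)"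
    using y(1) by (auto simp: signs_Suc e_def)
  ultimately show ?case
    using y(2) nn by (intro bexI[of _ "e # y"])
      (auto simp: sum.lessThan_Suc_shift add.assoc max_def split: if_splits simp del: sum.lessThan_Suc)
qed

section \<open>Avoiding a recurrent set of prefixes\<close>

text \<open>Finite-horizon form of the event that \<open>B\<close> fails at every time from
  \<open>m\<close> on. \<open>B\<close> sees the whole prefix, so it may depend on the entire
  history and on the time.\<close>

definition avoiding :: "(real list \<Rightarrow> bool) \<Rightarrow> nat \<Rightarrow> nat \<Rightarrow> real list set" where
  "avoiding B m N = {x \<in> signs N. \<forall>n\<in>{m..N}. \<not> B (take n x)}"

text \<open>Only two facts are kept about an avoiding list of length \<open>N + k\<close>: its first
  \<open>N\<close> signs avoid \<open>B\<close>, and \<open>B\<close> fails at the final time. Each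
  such prefix then retains at most the fraction \<open>1 - d\<close> of its continuations.\<close>

lemma card_avoiding_step:
  assumes "m \<le> N" and d: "\<And>s. s \<in> signs N \<Longrightarrow> d * 2 ^ k \<le> real (card {y \<in> signs k. B (s @ y)})"
  shows "real (card (avoiding B m (N + k))) / 2 ^ (N + k) \<le> (1 - d) * (real (card (avoiding B m N)) / 2 ^ N)"
proof -
  let ?F = "SIGMA s:avoiding B m N. {y \<in> signs k. \<not> B (s @ y)}"
  have "avoiding B m (N + k) \<subseteq> (\<lambda>(s, y). s @ y) ` ?F"
  proof
    fix x assume x: "x \<in> avoiding B m (N + k)"
    then have xs: "x \<in> signs (N + k)" and len: "length x = N + k"
      by (auto simp: avoiding_def signs_def)
    have "\<not> B (take n (take N x))" if "n \<in> {m..N}" for n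
    proof -
      have "\<not> B (take n x)" using x that by (auto simp: avoiding_def)
      then show ?thesis using that by (simp add: min_def)
    qed
    then have "take N x \<in> avoiding B m N"
      using take_drop_in_signs(1)[OF xs] by (simp add: avoiding_def)
    moreover have "\<not> B (take N x @ drop N x)"
    proof -
      have "\<not> B (take (N + k) x)" using x \<open>m \<le> N\<close> unfolding avoiding_def by auto
      then show ?thesis using len by simp
    qed
    ultimately have "(take N x, drop N x) \<in> ?F"
      using take_drop_in_signs(2)[OF xs] by simp
    then show "x \<in> (\<lambda>(s, y). s @ y) ` ?F"
      by (rule rev_image_eqI) simp
  qed
  moreover have fin: "finite (avoiding B m N)" by (simp add: avoiding_def)
  ultimately have "card (avoiding B m (N + k)) \<le> card ?F"
    by (intro surj_card_le) auto
  also have "card ?F = (\<Sum>s\<in>avoiding B m N. card {y \<in> signs k. \<not> B (s @ y)})"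
    using fin by (intro card_SigmaI) auto
  finally have "real (card (avoiding B m (N + k))) \<le>
      (\<Sum>s\<in>avoiding B m N. real (card {y \<in> signs k. \<not> B (s @ y)}))"
    by (simp flip: of_nat_sum)
  also have "\<dots> \<le> (\<Sum>s\<in>avoiding B m N. (1 - d) * 2 ^ k)"
  proof (rule sum_mono)
    fix s assume "s \<in> avoiding B m N"
    then have "d * 2 ^ k \<le> real (card {y \<in> signs k. B (s @ y)})"
      by (intro d) (simp add: avoiding_def)
    moreover have "card (signs k) = card {y \<in> signs k. B (s @ y)} + card {y \<in> signs k. \<not> B (s @ y)}"
      by (subst card_Un_disjoint[symmetric]) (auto intro!: arg_cong[where f = card])
    moreover have "real (card (signs k)) = 2 ^ k" by (simp add: card_signs)
    ultimately show "real (card {y \<in> signs k. \<not> B (s @ y)}) \<le> (1 - d) * 2 ^ k"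
      by (simp add: algebra_simps)
  qed
  finally show ?thesis
    by (simp add: power_add field_simps)
qed

text \<open>The fraction decreases to a limit \<open>L\<close>. If \<open>L\<close> were positive, a
  value below \<open>L + d * L\<close> would fall below \<open>L\<close> after one more block. Only
  \<open>d\<close> has to be uniform; the block length \<open>k\<close> may vary with
  \<open>N\<close>.\<close>

lemma avoiding_fraction_tendsto_0:
  assumes "0 < d"
    and d: "\<And>N. m \<le> N \<Longrightarrow> \<exists>k. \<forall>s\<in>signs N. d * 2 ^ k \<le> real (card {y \<in> signs k. B (s @ y)})"
  shows "(\<lambda>N. real (card (avoiding B m N)) / 2 ^ N) \<longlonglongrightarrow> 0"
proof -
  define q where "q N = real (card (avoiding B m N)) / 2 ^ N" for N
  have q0: "0 \<le> q N" for N by (simp add: q_def)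
  have "decseq (\<lambda>N. q (N + m))"
  proof (rule decseq_SucI)
    fix N
    \<comment> \<open>Monotonicity is the block estimate with \<open>d = 0\<close> and
      \<open>k = 1\<close>.\<close>
    show "q (Suc N + m) \<le> q (N + m)"
      using card_avoiding_step[of m "N + m" 0 1 B] by (simp add: q_def)
  qed
  moreover have "\<forall>N. 0 \<le> q (N + m)" by (simp add: q0)
  ultimately obtain L where L: "(\<lambda>N. q (N + m)) \<longlonglongrightarrow> L" "\<forall>N. L \<le> q (N + m)"
    by (rule decseq_convergent)
  have "L \<le> 0"
  proof (rule ccontr)
    assume "\<not> L \<le> 0"
    then have "L < L + d * L" using \<open>0 < d\<close> by simp
    with L(1) have "\<forall>\<^sub>F N in sequentially. q (N + m) < L + d * L"
      by (rule order_tendstoD(2))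
    then obtain N where N: "q (N + m) < L + d * L"
      using eventually_happens' sequentially_bot by blast
    obtain k where "\<forall>s\<in>signs (N + m). d * 2 ^ k \<le> real (card {y \<in> signs k. B (s @ y)})"
      using d[of "N + m"] by auto
    then have "q (N + m + k) \<le> (1 - d) * q (N + m)"
      using card_avoiding_step[of m "N + m" d k B] by (simp add: q_def)
    also have "\<dots> < L"
    proof -
      have "d * L \<le> d * q (N + m)" using L(2) \<open>0 < d\<close> by (intro mult_left_mono) auto
      then show ?thesis using N unfolding left_diff_distrib by linarith
    qed
    finally show False using L(2)[rule_format, of "N + k"] by (simp add: add_ac)
  qed
  moreover have "0 \<le> L" by (rule LIMSEQ_le_const[OF L(1)]) (simp add: q0)
  ultimately have "(\<lambda>N. q (N + m)) \<longlonglongrightarrow> 0" using L(1) by simp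
  then show ?thesis unfolding q_def by (rule LIMSEQ_offset)
qed

section \<open>Product measure of the signs and almost sure hits\<close>

interpretation Rad: prob_space Rad
  unfolding Rad_def by (intro prob_space_PiM measure_pmf.prob_space_axioms)

lemma space_Rad [simp]: "space Rad = UNIV"
  by (simp add: Rad_def space_PiM PiE_def)

lemma measurable_coord_Rad [measurable]: "(\<lambda>\<omega>. \<omega> i) \<in> borel_measurable Rad"
proof -
  have "(\<lambda>\<omega>. \<omega> i) \<in> Rad \<rightarrow>\<^sub>M measure_pmf (pmf_of_set {-1, 1 :: real})"
    unfolding Rad_def by (rule measurable_component_singleton) simp
  moreover have "(\<lambda>x. x) \<in> measure_pmf (pmf_of_set {-1, 1 :: real}) \<rightarrow>\<^sub>M borel" by simp
  ultimately show ?thesis using measurable_compose by blast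
qed

text \<open>The signs are numbered from 1, so \<open>\<omega> i\<close> sits at list position
  \<open>i - 1\<close>. The event is a cylinder over \<open>n\<close> singletons of mass
  1/2.\<close>

lemma Rad_cylinder:
  assumes "x \<in> signs n"
  shows "{\<omega>. map \<omega> [1..<Suc n] = x} \<in> sets Rad"
    and "measure Rad {\<omega>. map \<omega> [1..<Suc n] = x} = 1 / 2 ^ n"
proof -
  interpret product_prob_space "\<lambda>_. measure_pmf (pmf_of_set {-1, 1 :: real})" UNIV
    by unfold_locales
  have len: "length x = n" and v: "\<And>i. i < n \<Longrightarrow> x ! i \<in> {-1, 1}"
    using length_signs[OF assms] signs_nth[OF assms] by auto
  let ?X = "\<lambda>i. {x ! (i - 1)}"
  have eq: "{\<omega>. map \<omega> [1..<Suc n] = x} =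
      prod_emb UNIV (\<lambda>_. measure_pmf (pmf_of_set {-1, 1})) {1..n} (Pi\<^sub>E {1..n} ?X)"
  proof -
    have "map \<omega> [1..<Suc n] = x \<longleftrightarrow> (\<forall>i\<in>{1..n}. \<omega> i = x ! (i - 1))" for \<omega>
    proof -
      have "map \<omega> [1..<Suc n] = x \<longleftrightarrow> (\<forall>i<n. \<omega> (Suc i) = x ! i)"
        by (simp add: list_eq_iff_nth_eq len del: upt_Suc)
      also have "\<dots> \<longleftrightarrow> (\<forall>i\<in>{1..n}. \<omega> i = x ! (i - 1))"
        by (metis (no_types, lifting) Suc_diff_1 Suc_le_eq atLeastAtMost_iff diff_Suc_1 less_Suc_eq_0_disj
            One_nat_def not_less_zero Suc_le_mono)
      finally show ?thesis .
    qed
    then show ?thesis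
      by (auto simp: prod_emb_def PiE_iff)
  qed
  show "{\<omega>. map \<omega> [1..<Suc n] = x} \<in> sets Rad"
    unfolding eq Rad_def by (intro sets_PiM_I) auto
  have "measure Rad {\<omega>. map \<omega> [1..<Suc n] = x} =
      (\<Prod>i\<in>{1..n}. measure_pmf.prob (pmf_of_set {-1, 1}) {x ! (i - 1)})"
    unfolding eq Rad_def by (intro measure_PiM_emb) auto
  also have "\<dots> = (\<Prod>i\<in>{1..n}. 1 / 2)"
  proof (intro prod.cong refl)
    fix i assume "i \<in> {1..n}"
    then have "x ! (i - 1) \<in> {-1, 1}" by (intro v) auto
    then show "measure_pmf.prob (pmf_of_set {-1, 1}) {x ! (i - 1)} = 1 / 2"
      by (auto simp: measure_pmf_single)
  qed
  finally show "measure Rad {\<omega>. map \<omega> [1..<Suc n] = x} = 1 / 2 ^ n"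
    by (simp add: power_divide)
qed

text \<open>A finite disjoint union of cylinders of equal mass; this turns probabilities of events
  in the first \<open>n\<close> signs into cardinalities.\<close>

lemma Rad_pattern_set:
  assumes "X \<subseteq> signs n"
  shows "{\<omega>. map \<omega> [1..<Suc n] \<in> X} \<in> sets Rad"
    and "measure Rad {\<omega>. map \<omega> [1..<Suc n] \<in> X} = real (card X) / 2 ^ n"
proof -
  have fin: "finite X" by (rule finite_subset[OF assms]) simp
  have eq: "{\<omega>. map \<omega> [1..<Suc n] \<in> X} = (\<Union>x\<in>X. {\<omega>. map \<omega> [1..<Suc n] = x})" by auto
  show "{\<omega>. map \<omega> [1..<Suc n] \<in> X} \<in> sets Rad"
    unfolding eq using assms by (intro sets.finite_UN fin Rad_cylinder(1)) auto
  have "measure Rad {\<omega>. map \<omega> [1..<Suc n] \<in> X} = (\<Sum>x\<in>X. measure Rad {\<omega>. map \<omega> [1..<Suc n] = x})"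
    unfolding eq using fin assms Rad_cylinder(1)
    by (intro Rad.finite_measure_finite_Union) (auto simp: disjoint_family_on_def simp del: upt_Suc One_nat_def)
  also have "\<dots> = (\<Sum>x\<in>X. 1 / 2 ^ n)"
    using assms by (intro sum.cong refl Rad_cylinder(2)) auto
  finally show "measure Rad {\<omega>. map \<omega> [1..<Suc n] \<in> X} = real (card X) / 2 ^ n" by simp
qed

text \<open>A hit by time \<open>N\<close> has probability one minus the avoiding fraction, and the
  union of these events over \<open>N\<close> is at least as likely as each of them.\<close>

lemma AE_Rad_hits:
  assumes "(\<lambda>N. real (card (avoiding B m N)) / 2 ^ N) \<longlonglongrightarrow> 0"
  shows "AE \<omega> in Rad. \<exists>n\<ge>m. B (map \<omega> [1..<Suc n])"
proof -
  define E where "E N = {\<omega>. map \<omega> [1..<Suc N] \<in> signs N - avoiding B m N}" for N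
  have E: "E N \<in> sets Rad" "measure Rad (E N) = 1 - real (card (avoiding B m N)) / 2 ^ N" for N
  proof -
    have sub: "avoiding B m N \<subseteq> signs N" by (auto simp: avoiding_def)
    show "E N \<in> sets Rad" unfolding E_def by (rule Rad_pattern_set(1)) auto
    have "measure Rad (E N) = real (card (signs N - avoiding B m N)) / 2 ^ N"
      unfolding E_def by (rule Rad_pattern_set(2)) auto
    also have "real (card (signs N - avoiding B m N)) = 2 ^ N - real (card (avoiding B m N))"
      using sub card_mono[OF _ sub]
      by (simp add: card_Diff_subset finite_subset of_nat_diff card_signs)
    finally show "measure Rad (E N) = 1 - real (card (avoiding B m N)) / 2 ^ N"
      by (simp add: diff_divide_distrib)
  qed
  have "1 - real (card (avoiding B m N)) / 2 ^ N \<le> measure Rad (\<Union>N. E N)" for N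
    unfolding E(2)[symmetric] using E(1) by (intro Rad.finite_measure_mono) auto
  moreover have "(\<lambda>N. 1 - real (card (avoiding B m N)) / 2 ^ N) \<longlonglongrightarrow> 1 - 0"
    by (intro tendsto_diff assms tendsto_const)
  ultimately have "1 - 0 \<le> measure Rad (\<Union>N. E N)"
    by (intro LIMSEQ_le_const2) auto
  then have "measure Rad (\<Union>N. E N) = 1"
    using Rad.prob_le_1[of "\<Union>N. E N"] by linarith
  then have "AE \<omega> in Rad. \<omega> \<in> (\<Union>N. E N)"
    using E(1) by (subst Rad.AE_in_set_eq_1) auto
  then show ?thesis
  proof eventually_elim
    case (elim \<omega>)
    then obtain N where "map \<omega> [1..<Suc N] \<in> signs N - avoiding B m N"
      by (auto simp: E_def)
    then obtain n where n: "m \<le> n" "n \<le> N" "B (take n (map \<omega> [1..<Suc N]))"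
      unfolding avoiding_def by auto
    have "take n (map \<omega> [1..<Suc N]) = map \<omega> [1..<Suc n]"
      using n(2) by (simp add: take_map take_upt del: upt_Suc)
    then show ?case using n by metis
  qed
qed

section \<open>Bounds on the coefficients\<close>

lemma integral_le_of_nonneg_bound:
  fixes f g :: "real \<Rightarrow> real"
  assumes "g integrable_on {a..b}" "\<And>x. a < x \<Longrightarrow> x < b \<Longrightarrow> f x \<le> g x"
    "\<And>x. a < x \<Longrightarrow> x < b \<Longrightarrow> 0 \<le> g x"
  shows "integral {a..b} f \<le> integral {a..b} g"
proof -
  have g: "g integrable_on {a<..<b}" using assms(1) by (simp add: integrable_on_open_interval_real)
  show ?thesis
  proof (cases "f integrable_on {a<..<b}")
    case True
    then show ?thesis unfolding integral_open_interval_real using g assms(2)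
      by (intro integral_le) auto
  next
    \<comment> \<open>A non-integrable function has integral 0 by convention, and
      \<open>0 \<le> g\<close> covers this value. Upper bounds thus apply to the kernels
      directly.\<close>
    case False
    then have "integral {a<..<b} f = 0" by (rule not_integrable_integral)
    moreover have "0 \<le> integral {a<..<b} g" using g assms(3) by (intro integral_nonneg) auto
    ultimately show ?thesis unfolding integral_open_interval_real by simp
  qed
qed

text \<open>The bound is asked only inside the interval: \<open>0 powr p = 0\<close> breaks
  comparisons of negative powers at an endpoint.\<close>

lemma integral_ge_of_open_bound:
  fixes f g :: "real \<Rightarrow> real"
  assumes "f integrable_on {a..b}" "g integrable_on {a..b}" "\<And>x. a < x \<Longrightarrow> x < b \<Longrightarrow> g x \<le> f x"
  shows "integral {a..b} g \<le> integral {a..b} f"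
  unfolding integral_open_interval_real
  using assms by (intro integral_le) (auto simp: integrable_on_open_interval_real)

lemma integral_nonneg_total:
  fixes f :: "real \<Rightarrow> real"
  assumes "\<And>x. a < x \<Longrightarrow> x < b \<Longrightarrow> 0 \<le> f x"
  shows "0 \<le> integral {a..b} f"
  using assms integral_nonneg[of f "{a<..<b}"]
  unfolding integral_open_interval_real
  by (cases "f integrable_on {a<..<b}") (auto simp: not_integrable_integral)

text \<open>The second mean value theorem for a monotone factor also yields integrability of the
  product. It serves for kernels that are an integrable power times a monotone function.\<close>

lemma integrable_mono_times:
  fixes f g :: "real \<Rightarrow> real"
  assumes "f integrable_on {a..b}" "\<And>x y. a \<le> x \<Longrightarrow> x \<le> y \<Longrightarrow> y \<le> b \<Longrightarrow> g x \<le> g y"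
  shows "(\<lambda>x. g x * f x) integrable_on {a..b}"
proof (cases "a \<le> b")
  case True
  show ?thesis
    by (rule second_mean_value_theorem_full[OF assms(1) True, of g]) (auto intro: assms(2))
qed (simp add: not_le integrable_on_empty)

lemma has_integral_affine_real:
  fixes f :: "real \<Rightarrow> real"
  assumes "(f has_integral I) {a..b}" "0 < m"
  shows "((\<lambda>x. f (m * x + c)) has_integral (I / m)) {(a - c) / m..(b - c) / m}"
  using has_integral_affinity'[of f I a b m c] assms by (simp add: divide_inverse mult_ac)

text \<open>Integrability passes in both directions, since the inverse of an affine map is affine;
  where it fails, both sides are the default value 0.\<close>

lemma integral_affine_real:
  fixes f :: "real \<Rightarrow> real"
  assumes "0 < m"
  shows "integral {(a - c) / m..(b - c) / m} (\<lambda>x. f (m * x + c)) = integral {a..b} f / m"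
proof (cases "f integrable_on {a..b}")
  case True
  then show ?thesis
    using has_integral_affine_real[OF integrable_integral assms] by (intro integral_unique)
next
  case False
  have "\<not> (\<lambda>x. f (m * x + c)) integrable_on {(a - c) / m..(b - c) / m}"
  proof
    assume "(\<lambda>x. f (m * x + c)) integrable_on {(a - c) / m..(b - c) / m}"
    then obtain I where "((\<lambda>x. f (m * x + c)) has_integral I) {(a - c) / m..(b - c) / m}" by auto
    from has_integral_affine_real[OF this, of "1 / m" "- c / m"] assms
    have "(f has_integral I / (1 / m)) {a..b}" by (simp add: field_simps)
    then show False using False by auto
  qed
  then show ?thesis using False by (simp add: not_integrable_integral)
qed

lemma has_integral_powr_shift:
  fixes p s t :: real
  assumes "-1 < p" "s \<le> t"
  shows "((\<lambda>u. (u - s) powr p) has_integral (t - s) powr (p + 1) / (p + 1)) {s..t}"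
  using has_integral_affine_real[OF has_integral_powr_from_0[of p "t - s"], of 1 "-s"] assms by simp

lemma has_integral_powr_reflect:
  fixes p s t :: real
  assumes "-1 < p" "s \<le> t"
  shows "((\<lambda>u. (t - u) powr p) has_integral (t - s) powr (p + 1) / (p + 1)) {s..t}"
  using has_integral_reflect_real[of "\<lambda>u. (t - u) powr p" _ t s]
    has_integral_powr_shift[of p "-t" "-s"] assms by (simp add: add.commute)

lemma integral_powr_unit:
  assumes "-1 < p"
  shows "(\<lambda>y. y powr p) integrable_on {0..1::real}" "integral {0..1::real} (\<lambda>y. y powr p) = 1 / (p + 1)"
  using has_integral_powr_from_0[of p 1] assms by (auto intro: integral_unique)

lemma powr_mono_neg:
  fixes p :: real
  assumes "p \<le> 0" "0 < x" "x \<le> y"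
  shows "y powr p \<le> x powr p"
  using powr_mono2'[of p x y] assms by simp

lemma integrable_powr_neg_cell:
  assumes "1/2 < H" "H < 1" "1 \<le> i"
  shows "(\<lambda>x. x powr (1/2 - H)) integrable_on {real i - 1..real i}"
proof -
  have "(\<lambda>x. x powr (1/2 - H)) integrable_on {0..real i}"
    using has_integral_powr_from_0[of "1/2 - H" "real i"] assms by auto
  then show ?thesis
    by (rule integrable_subinterval_real) (use assms in auto)
qed

lemma integral_powr_neg_cell_le:
  assumes "1/2 < H" "H < 1" "1 \<le> i"
  shows "integral {real i - 1..real i} (\<lambda>x. x powr (1/2 - H)) \<le> 2"
    and "2 \<le> i \<Longrightarrow> integral {real i - 1..real i} (\<lambda>x. x powr (1/2 - H)) \<le> (real i - 1) powr (1/2 - H)"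
proof -
  have "integral {real i - 1..real i} (\<lambda>x. x powr (1/2 - H)) \<le>
      integral {real i - 1..real i} (\<lambda>x. (x - (real i - 1)) powr (1/2 - H))"
    using has_integral_powr_shift[of "1/2 - H" "real i - 1" "real i"] assms
    by (intro integral_ge_of_open_bound integrable_powr_neg_cell powr_mono_neg) auto
  also have "\<dots> = 1 / (3/2 - H)"
    using has_integral_powr_shift[of "1/2 - H" "real i - 1" "real i"] assms
    by (intro integral_unique) simp
  also have "\<dots> \<le> 2" using assms by (simp add: field_simps)
  finally show "integral {real i - 1..real i} (\<lambda>x. x powr (1/2 - H)) \<le> 2" .
  assume "2 \<le> i"
  then have "integral {real i - 1..real i} (\<lambda>x. x powr (1/2 - H)) \<le>
      integral {real i - 1..real i} (\<lambda>_. (real i - 1) powr (1/2 - H))"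
    using assms by (intro integral_le_of_nonneg_bound powr_mono_neg) auto
  then show "integral {real i - 1..real i} (\<lambda>x. x powr (1/2 - H)) \<le> (real i - 1) powr (1/2 - H)"
    by simp
qed

section \<open>Bounds for single coefficients\<close>

lemma CH_pos: "1/2 < H \<Longrightarrow> H < 1 \<Longrightarrow> 0 < CH H"
  unfolding CH_def cH_def by (intro mult_pos_pos real_sqrt_gt_zero divide_pos_pos Gamma_real_pos) auto

lemma jH_nonneg:
  assumes "0 < \<sigma>" "1/2 < H" "H < 1"
  shows "0 \<le> jH \<sigma> H n i"
  unfolding jH_def using CH_pos[of H] assms
  by (intro mult_nonneg_nonneg integral_nonneg_total) auto

text \<open>Since \<open>v + n - 1\<close> is at least \<open>x\<close>, its power
  \<open>H - 1/2\<close> is at least the one that cancels \<open>x powr (1/2 - H)\<close>. The other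
  factor is smallest when \<open>v + n - 1 - x\<close> takes its largest value
  \<open>n - i + 1\<close>.\<close>

lemma jH_lower:
  assumes "0 < \<sigma>" "1/2 < H" "H < 1" "1 \<le> i" "i + 1 < n"
  shows "\<sigma> * CH H * (real n - real i + 1) powr (H - 3/2) \<le> jH \<sigma> H n i"
proof -
  let ?G = "\<lambda>x. integral {0..1} (\<lambda>v. (v + real n - 1) powr (H - 1/2) * (v + real n - 1 - x) powr (H - 3/2))"
  have int: "(\<lambda>v. (v + real n - 1) powr (H - 1/2) * (v + real n - 1 - x) powr (H - 3/2)) integrable_on {0..1}"
    if "x \<le> real i" for x
    using that assms by (intro integrable_continuous_real continuous_intros) auto
  have mono: "?G x \<le> ?G y" if "x \<le> y" "y \<le> real i" for x y
    using that assms by (intro integral_le int mult_left_mono powr_mono_neg) auto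
  \<comment> \<open>The inner integral increases with \<open>x\<close>, so its product with the
    singular power is integrable.\<close>
  have "(\<lambda>x. ?G x * x powr (1/2 - H)) integrable_on {real i - 1..real i}"
    using assms mono by (intro integrable_mono_times[where g = ?G] integrable_powr_neg_cell) auto
  then have outer: "(\<lambda>x. x powr (1/2 - H) * ?G x) integrable_on {real i - 1..real i}"
    by (simp add: mult.commute)
  have "integral {real i - 1..real i} (\<lambda>_. (real n - real i + 1) powr (H - 3/2)) \<le>
      integral {real i - 1..real i} (\<lambda>x. x powr (1/2 - H) * ?G x)"
  proof (intro integral_ge_of_open_bound outer integrable_const_ivl)
    fix x assume x: "real i - 1 < x" "x < real i"
    have "x powr (H - 1/2) * (real n - real i + 1) powr (H - 3/2) =
        integral {0..1::real} (\<lambda>_. x powr (H - 1/2) * (real n - real i + 1) powr (H - 3/2))" by simp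
    also have "\<dots> \<le> ?G x"
      using x assms by (intro integral_le int integrable_const_ivl mult_mono powr_mono2 powr_mono_neg) auto
    finally have "x powr (1/2 - H) * (x powr (H - 1/2) * (real n - real i + 1) powr (H - 3/2)) \<le> x powr (1/2 - H) * ?G x"
      by (intro mult_left_mono) auto
    moreover have "x powr (1/2 - H) * x powr (H - 1/2) = 1"
      using x assms by (simp flip: powr_add)
    ultimately show "(real n - real i + 1) powr (H - 3/2) \<le> x powr (1/2 - H) * ?G x"
      by (simp flip: mult.assoc)
  qed
  then show ?thesis
    unfolding jH_def using CH_pos[of H] assms by (intro mult_left_mono) auto
qed

text \<open>Away from the diagonal the kernel has no singularity: \<open>v + n - 1\<close> is at
  most \<open>n\<close>, and \<open>v + n - 1 - x\<close> is at least
  \<open>n - i - 1 > 0\<close>.\<close>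

lemma jH_upper_smooth:
  assumes "0 < \<sigma>" "1/2 < H" "H < 1" "1 \<le> i" "i + 1 < n"
  shows "jH \<sigma> H n i \<le> \<sigma> * CH H * (real n powr (H - 1/2) * (real n - real i - 1) powr (H - 3/2) *
    integral {real i - 1..real i} (\<lambda>x. x powr (1/2 - H)))"
proof -
  let ?G = "\<lambda>x. integral {0..1} (\<lambda>v. (v + real n - 1) powr (H - 1/2) * (v + real n - 1 - x) powr (H - 3/2))"
  let ?c = "real n powr (H - 1/2) * (real n - real i - 1) powr (H - 3/2)"
  have "integral {real i - 1..real i} (\<lambda>x. x powr (1/2 - H) * ?G x) \<le>
      integral {real i - 1..real i} (\<lambda>x. x powr (1/2 - H) * ?c)"
  proof (intro integral_le_of_nonneg_bound mult_left_mono)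
    fix x assume x: "real i - 1 < x" "x < real i"
    have "?G x \<le> integral {0..1::real} (\<lambda>_. ?c)"
      using x assms by (intro integral_le_of_nonneg_bound mult_mono powr_mono2 powr_mono_neg) auto
    then show "?G x \<le> ?c" by simp
  qed (use assms integrable_powr_neg_cell in \<open>auto intro: integrable_on_mult_left\<close>)
  then show ?thesis
    unfolding jH_def using CH_pos[of H] assms by (intro mult_left_mono) (auto simp: mult.commute)
qed

text \<open>Near the diagonal the kernel \<open>(v + u) powr (H - 3/2)\<close> with \<open>u = i - x\<close> is split as
  \<open>v powr (H - 1) * u powr (- 1 / 2)\<close>, which keeps the constant bounded as \<open>H\<close> tends to \<open>1/2\<close>.\<close>

lemma jH_upper_diagonal:
  assumes "0 < \<sigma>" "1/2 < H" "H < 1" "2 \<le> i" "i < n"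
  shows "jH \<sigma> H n i \<le> \<sigma> * CH H * (4 * (real n / (real i - 1)) powr (H - 1/2))"
proof -
  let ?G = "\<lambda>x. integral {0..1} (\<lambda>v. (v + real n - 1) powr (H - 1/2) * (v + real n - 1 - x) powr (H - 3/2))"
  let ?c = "(real i - 1) powr (1/2 - H) * (real n powr (H - 1/2) * 2)"
  \<comment> \<open>Both factors of the split kernel integrate to at most 2:
    \<open>v powr (H - 1)\<close> to \<open>1 / H\<close> and the inverse square root to 2. This
    gives the constant 4.\<close>
  have half: "((\<lambda>x. (real i - x) powr (-1/2)) has_integral 2) {real i - 1..real i}"
    using has_integral_powr_reflect[of "-1/2" "real i - 1" "real i"] by simp
  have Gb: "?G x \<le> real n powr (H - 1/2) * 2 * (real i - x) powr (-1/2)"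
    if x: "real i - 1 < x" "x < real i" for x
  proof -
    have "?G x \<le> integral {0..1} (\<lambda>v. real n powr (H - 1/2) * (real i - x) powr (-1/2) * v powr (H - 1))"
    proof (intro integral_le_of_nonneg_bound)
      fix v :: real assume v: "0 < v" "v < 1"
      let ?w = "v + real n - 1 - x"
      have le: "v \<le> ?w" "real i - x \<le> ?w" using v x assms by auto
      have "?w powr (H - 3/2) = ?w powr (-1/2) * ?w powr (H - 1)"
        by (simp flip: powr_add)
      also have "\<dots> \<le> (real i - x) powr (-1/2) * v powr (H - 1)"
        using le v x assms by (intro mult_mono powr_mono_neg) auto
      finally have "(v + real n - 1) powr (H - 1/2) * ?w powr (H - 3/2) \<le>
          real n powr (H - 1/2) * ((real i - x) powr (-1/2) * v powr (H - 1))"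
        using v assms by (intro mult_mono powr_mono2) auto
      then show "(v + real n - 1) powr (H - 1/2) * ?w powr (H - 3/2) \<le>
          real n powr (H - 1/2) * (real i - x) powr (-1/2) * v powr (H - 1)" by (simp add: mult.assoc)
    qed (use integral_powr_unit(1)[of "H - 1"] assms in \<open>auto intro: integrable_on_mult_right\<close>)
    also have "\<dots> = real n powr (H - 1/2) * (real i - x) powr (-1/2) * (1 / H)"
      using integral_powr_unit(2)[of "H - 1"] assms by simp
    also have "\<dots> \<le> real n powr (H - 1/2) * (real i - x) powr (-1/2) * 2"
      using assms by (intro mult_left_mono) (auto simp: field_simps)
    finally show ?thesis by (simp add: mult_ac)
  qed
  have "integral {real i - 1..real i} (\<lambda>x. x powr (1/2 - H) * ?G x) \<le>
      integral {real i - 1..real i} (\<lambda>x. ?c * (real i - x) powr (-1/2))"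
  proof (intro integral_le_of_nonneg_bound)
    fix x assume x: "real i - 1 < x" "x < real i"
    have "x powr (1/2 - H) * ?G x \<le>
        (real i - 1) powr (1/2 - H) * (real n powr (H - 1/2) * 2 * (real i - x) powr (-1/2))"
      using x assms Gb[OF x] by (intro mult_mono powr_mono_neg integral_nonneg_total) auto
    then show "x powr (1/2 - H) * ?G x \<le> ?c * (real i - x) powr (-1/2)"
      by (simp add: mult_ac)
  qed (use half in \<open>auto intro: integrable_on_mult_right\<close>)
  also have "\<dots> = ?c * 2"
    using half by (simp add: integral_unique)
  also have "\<dots> = 4 * (real n / (real i - 1)) powr (H - 1/2)"
    using assms powr_minus_divide[of "real i - 1" "H - 1/2"] by (simp add: powr_divide)
  finally show ?thesis
    unfolding jH_def using CH_pos[of H] assms by (intro mult_left_mono) auto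
qed

text \<open>The base \<open>y * (n - x) + x\<close> is a convex combination of \<open>n\<close> and
  \<open>x\<close>, hence at most \<open>n\<close>. The quotient \<open>n / x\<close> that remains
  is at most 2 because \<open>n \<ge> 2\<close>.\<close>

lemma gH_upper:
  assumes "0 < \<sigma>" "1/2 < H" "H < 1" "2 \<le> n"
  shows "gH \<sigma> H n \<le> \<sigma> * CH H * (2 / (H - 1/2))"
proof -
  let ?G = "\<lambda>x. integral {0..1} (\<lambda>y. (y * (real n - x) + x) powr (H - 1/2) * y powr (H - 3/2))"
  have "integral {real n - 1..real n} (\<lambda>x. x powr (1/2 - H) * (real n - x) powr (H - 1/2) * ?G x) \<le>
      integral {real n - 1..real n} (\<lambda>x. 2 / (H - 1/2))"
  proof (intro integral_le_of_nonneg_bound)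
    fix x assume x: "real n - 1 < x" "x < real n"
    have "?G x \<le> integral {0..1} (\<lambda>y. real n powr (H - 1/2) * y powr (H - 3/2))"
    proof (intro integral_le_of_nonneg_bound mult_right_mono powr_mono2)
      fix y :: real assume y: "0 < y" "y < 1"
      then have "y * (real n - x) \<le> 1 * (real n - x)" using x by (intro mult_right_mono) auto
      then show "y * (real n - x) + x \<le> real n" by simp
      show "0 \<le> y * (real n - x) + x" using x y assms by (intro add_nonneg_nonneg mult_nonneg_nonneg) auto
    qed (use integral_powr_unit(1)[of "H - 3/2"] assms in \<open>auto intro: integrable_on_mult_right\<close>)
    also have "\<dots> = real n powr (H - 1/2) * (1 / (H - 1/2))"
      using integral_powr_unit(2)[of "H - 3/2"] assms by simp
    finally have G: "?G x \<le> real n powr (H - 1/2) * (1 / (H - 1/2))" .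
    have "(real n - x) powr (H - 1/2) \<le> 1 powr (H - 1/2)"
      using x assms by (intro powr_mono2) auto
    then have "x powr (1/2 - H) * (real n - x) powr (H - 1/2) * ?G x \<le>
        x powr (1/2 - H) * 1 * (real n powr (H - 1/2) * (1 / (H - 1/2)))"
      using G by (intro mult_mono integral_nonneg_total) auto
    also have "\<dots> = (real n / x) powr (H - 1/2) * (1 / (H - 1/2))"
      using x assms powr_minus_divide[of x "H - 1/2"] by (simp add: powr_divide)
    also have "\<dots> \<le> 2 * (1 / (H - 1/2))"
    proof (intro mult_right_mono)
      have "real n / x \<le> 2" "1 \<le> real n / x" using x assms by (auto simp: field_simps)
      then have "(real n / x) powr (H - 1/2) \<le> (real n / x) powr 1"
        using assms by (intro powr_mono) auto
      then show "(real n / x) powr (H - 1/2) \<le> 2" using \<open>real n / x \<le> 2\<close> \<open>1 \<le> real n / x\<close> by simp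
    qed (use assms in auto)
    finally show "x powr (1/2 - H) * (real n - x) powr (H - 1/2) * ?G x \<le> 2 / (H - 1/2)" by simp
  qed (use assms in auto)
  then show ?thesis
    unfolding gH_def using CH_pos[of H] assms by (intro mult_left_mono) auto
qed

text \<open>The same convex combination is at least \<open>x\<close>, so its power cancels
  \<open>x powr (1/2 - H)\<close>. The factor \<open>1 / (H - 1/2)\<close> comes from the inner
  integral, \<open>1 / (H + 1/2)\<close> from the outer one.\<close>

lemma gH_lower:
  assumes "0 < \<sigma>" "1/2 < H" "H < 1" "2 \<le> n"
  shows "\<sigma> * CH H * (1 / ((H - 1/2) * (H + 1/2))) \<le> gH \<sigma> H n"
proof -
  let ?G = "\<lambda>x. integral {0..1} (\<lambda>y. (y * (real n - x) + x) powr (H - 1/2) * y powr (H - 3/2))"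
  have int: "(\<lambda>y. (y * (real n - x) + x) powr (H - 1/2) * y powr (H - 3/2)) integrable_on {0..1}"
    if "0 \<le> x" "x \<le> real n" for x
  proof (intro integrable_mono_times[where f = "\<lambda>y. y powr (H - 3/2)"] integral_powr_unit(1) powr_mono2)
    fix y z :: real assume "0 \<le> y" "y \<le> z" "z \<le> 1"
    then show "0 \<le> y * (real n - x) + x" "y * (real n - x) + x \<le> z * (real n - x) + x"
      using that by (auto intro!: add_nonneg_nonneg mult_right_mono)
  qed (use assms in auto)
  have mono: "?G x \<le> ?G x'" if x: "0 \<le> x" "x \<le> x'" "x' \<le> real n" for x x'
  proof (intro integral_le int mult_right_mono powr_mono2)
    fix y :: real assume "y \<in> {0..1}"
    then show "0 \<le> y * (real n - x) + x" using x by (auto intro!: add_nonneg_nonneg)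
    have "0 \<le> (1 - y) * (x' - x)" using x \<open>y \<in> {0..1}\<close> by (intro mult_nonneg_nonneg) auto
    then show "y * (real n - x) + x \<le> y * (real n - x') + x'" by (simp add: algebra_simps)
  qed (use x assms in auto)
  have "(\<lambda>x. x powr (1/2 - H) * (real n - x) powr (H - 1/2)) integrable_on {real n - 1..real n}"
    using assms by (intro integrable_continuous_real continuous_on_mult continuous_on_powr' continuous_intros) auto
  then have "(\<lambda>x. ?G x * (x powr (1/2 - H) * (real n - x) powr (H - 1/2))) integrable_on {real n - 1..real n}"
    using assms mono by (intro integrable_mono_times[where g = ?G]) auto
  then have outer: "(\<lambda>x. x powr (1/2 - H) * (real n - x) powr (H - 1/2) * ?G x) integrable_on {real n - 1..real n}"
    by (simp add: mult_ac)
  have pw: "((\<lambda>x. (real n - x) powr (H - 1/2)) has_integral 1 / (H + 1/2)) {real n - 1..real n}"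
    using has_integral_powr_reflect[of "H - 1/2" "real n - 1" "real n"] assms by (simp add: add.commute)
  have "1 / ((H - 1/2) * (H + 1/2)) =
      integral {real n - 1..real n} (\<lambda>x. 1 / (H - 1/2) * (real n - x) powr (H - 1/2))"
    using pw by (simp add: integral_unique)
  also have "\<dots> \<le> integral {real n - 1..real n} (\<lambda>x. x powr (1/2 - H) * (real n - x) powr (H - 1/2) * ?G x)"
  proof (intro integral_ge_of_open_bound outer)
    fix x assume x: "real n - 1 < x" "x < real n"
    have "x powr (H - 1/2) * (1 / (H - 1/2)) = integral {0..1} (\<lambda>y. x powr (H - 1/2) * y powr (H - 3/2))"
      using integral_powr_unit(2)[of "H - 3/2"] assms by simp
    also have "\<dots> \<le> ?G x"
      using x assms integral_powr_unit(1)[of "H - 3/2"]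
      by (intro integral_le int mult_right_mono powr_mono2) (auto intro: integrable_on_mult_right)
    finally have "x powr (1/2 - H) * (real n - x) powr (H - 1/2) * (x powr (H - 1/2) * (1 / (H - 1/2))) \<le>
        x powr (1/2 - H) * (real n - x) powr (H - 1/2) * ?G x"
      by (intro mult_left_mono) auto
    moreover have "x powr (1/2 - H) * (real n - x) powr (H - 1/2) * (x powr (H - 1/2) * (1 / (H - 1/2))) =
        (x powr (1/2 - H) * x powr (H - 1/2)) * (1 / (H - 1/2) * (real n - x) powr (H - 1/2))"
      by (simp only: mult_ac)
    moreover have "x powr (1/2 - H) * x powr (H - 1/2) = 1"
      using x assms by (simp flip: powr_add)
    ultimately show "1 / (H - 1/2) * (real n - x) powr (H - 1/2) \<le>
        x powr (1/2 - H) * (real n - x) powr (H - 1/2) * ?G x"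
      by (simp only: mult_1_left)
  qed (intro integrable_on_mult_right has_integral_integrable[OF pw])
  finally show ?thesis
    unfolding gH_def using CH_pos[of H] assms by (intro mult_left_mono) auto
qed

section \<open>Blocks of equal signs and large values\<close>

text \<open>The value of \<open>YH\<close> at time \<open>Suc (length x)\<close>: time
  \<open>n\<close> uses the signs 1 to \<open>n - 1\<close>, and list position \<open>i\<close>
  holds the sign numbered \<open>Suc i\<close>. All weights depend on the final time, so extending
  \<open>x\<close> changes every one of them.\<close>

definition path_sum :: "real \<Rightarrow> real \<Rightarrow> real list \<Rightarrow> real" where
  "path_sum \<sigma> H x = wsum (\<lambda>i. jH \<sigma> H (Suc (length x)) (Suc i)) x"

text \<open>All but the last of the \<open>K\<close> coefficients nearest the diagonal are at least
  a constant times \<open>(K + 1) powr (H - 3/2)\<close>. Their sum grows like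
  \<open>K powr (H - 1/2)\<close>, uniformly in \<open>N\<close>.\<close>

lemma jH_block_sum_unbounded:
  assumes "0 < \<sigma>" "1/2 < H" "H < 1"
  shows "\<exists>K\<ge>2. \<forall>N. C \<le> (\<Sum>l<K. jH \<sigma> H (Suc (N + K)) (Suc (N + l)))"
proof -
  define D where "D = \<sigma> * CH H"
  have D: "0 < D" using CH_pos[of H] assms by (simp add: D_def)
  define X where "X = max 1 (3 * C / D)"
  \<comment> \<open>Chosen so that \<open>X \<le> (K + 1) powr (H - 1/2)\<close>. The summand 2
    ensures \<open>(K + 1) / 3 \<le> K - 1\<close>, which is the source of the 3 in
    \<open>X\<close>.\<close>
  define K where "K = nat \<lceil>X powr (1 / (H - 1/2))\<rceil> + 2"
  have "X powr (1 / (H - 1/2)) \<le> real K + 1"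
    unfolding K_def by linarith
  then have "(X powr (1 / (H - 1/2))) powr (H - 1/2) \<le> (real K + 1) powr (H - 1/2)"
    using assms by (intro powr_mono2) auto
  then have X: "X \<le> (real K + 1) powr (H - 1/2)"
    using assms by (simp add: powr_powr X_def)
  have K2: "2 \<le> K" by (simp add: K_def)
  have "C \<le> (\<Sum>l<K. jH \<sigma> H (Suc (N + K)) (Suc (N + l)))" for N
  proof -
    have "C \<le> D * (X / 3)" using D by (simp add: X_def max_def field_simps)
    also have "\<dots> \<le> D * ((real K + 1) powr (H - 1/2) / 3)"
      using X D by (intro mult_left_mono) auto
    also have "\<dots> = D * ((real K + 1) / 3 * (real K + 1) powr (H - 3/2))"
    proof -
      have "(real K + 1) powr (H - 1/2) = (real K + 1) powr 1 * (real K + 1) powr (H - 3/2)"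
        unfolding powr_add[symmetric] by simp
      then show ?thesis by simp
    qed
    also have "\<dots> \<le> D * (real (K - 1) * (real K + 1) powr (H - 3/2))"
      using D K2 by (intro mult_left_mono mult_right_mono) auto
    also have "\<dots> = (\<Sum>l<K - 1. D * (real K + 1) powr (H - 3/2))" by simp
    also have "\<dots> \<le> (\<Sum>l<K - 1. jH \<sigma> H (Suc (N + K)) (Suc (N + l)))"
    proof (rule sum_mono)
      fix l assume l: "l \<in> {..<K - 1}"
      have "D * (real K + 1) powr (H - 3/2) \<le> D * (real (Suc (N + K)) - real (Suc (N + l)) + 1) powr (H - 3/2)"
        using D l assms by (intro mult_left_mono powr_mono_neg) auto
      also have "\<dots> \<le> jH \<sigma> H (Suc (N + K)) (Suc (N + l))"
        unfolding D_def using l assms by (intro jH_lower) auto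
      finally show "D * (real K + 1) powr (H - 3/2) \<le> jH \<sigma> H (Suc (N + K)) (Suc (N + l))" .
    qed
    \<comment> \<open>The term \<open>l = K - 1\<close> is the coefficient next to the diagonal,
      outside the range of \<open>jH_lower\<close>; only its nonnegativity enters.\<close>
    also have "\<dots> \<le> (\<Sum>l<K. jH \<sigma> H (Suc (N + K)) (Suc (N + l)))"
      using jH_nonneg assms by (intro sum_mono2) auto
    finally show ?thesis .
  qed
  with K2 show ?thesis by blast
qed

text \<open>One good continuation out of \<open>2 ^ K\<close> suffices, so
  \<open>d = 1 / 2 ^ K\<close>. The margin 1 above \<open>gH\<close> is reserved for the drift of
  the market.\<close>

lemma path_sum_large_hits:
  assumes "0 < \<sigma>" "1/2 < H" "H < 1"
  shows "\<exists>d>0. \<forall>N\<ge>1. \<exists>k. \<forall>s\<in>signs N. d * 2 ^ k \<le>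
    real (card {y \<in> signs k. gH \<sigma> H (Suc (length (s @ y))) + 1 \<le> \<bar>path_sum \<sigma> H (s @ y)\<bar>})"
proof -
  obtain K where K: "2 \<le> K" "\<And>N. \<sigma> * CH H * (2 / (H - 1/2)) + 1 \<le>
      (\<Sum>l<K. jH \<sigma> H (Suc (N + K)) (Suc (N + l)))"
    using jH_block_sum_unbounded[OF assms] by metis
  have "1 / 2 ^ K * 2 ^ K \<le> real (card {y \<in> signs K. gH \<sigma> H (Suc (length (s @ y))) + 1 \<le> \<bar>path_sum \<sigma> H (s @ y)\<bar>})"
    (is "_ \<le> real (card ?A)") if "1 \<le> N" "s \<in> signs N" for N s
  proof -
    let ?b = "\<lambda>i. jH \<sigma> H (Suc (N + K)) (Suc i)"
    \<comment> \<open>The sign of the prefix sum is taken with the weights of the final time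
      \<open>Suc (N + K)\<close>, so the block adds to its modulus.\<close>
    define e :: real where "e = (if wsum ?b s \<ge> 0 then 1 else -1)"
    let ?y = "replicate K e"
    have y: "?y \<in> signs K" by (auto simp: signs_def e_def)
    have len: "length s = N" using that by (simp add: signs_def)
    have "path_sum \<sigma> H (s @ ?y) = wsum ?b s + (\<Sum>l<K. jH \<sigma> H (Suc (N + K)) (Suc (N + l))) * e"
      by (simp add: path_sum_def wsum_append wsum_replicate len)
    moreover have "0 \<le> (\<Sum>l<K. jH \<sigma> H (Suc (N + K)) (Suc (N + l)))"
      using jH_nonneg assms by (intro sum_nonneg) auto
    ultimately have "(\<Sum>l<K. jH \<sigma> H (Suc (N + K)) (Suc (N + l))) \<le> \<bar>path_sum \<sigma> H (s @ ?y)\<bar>"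
      by (auto simp: e_def)
    moreover have "gH \<sigma> H (Suc (N + K)) \<le> \<sigma> * CH H * (2 / (H - 1/2))"
      using assms K(1) by (intro gH_upper) auto
    ultimately have "?y \<in> ?A" using y K(2)[of N] len by simp
    then have "0 < card ?A" by (intro card_gt_0_iff[THEN iffD2]) auto
    then show ?thesis by simp
  qed
  then have "\<forall>N\<ge>1. \<exists>k. \<forall>s\<in>signs N. 1 / 2 ^ K * 2 ^ k \<le>
      real (card {y \<in> signs k. gH \<sigma> H (Suc (length (s @ y))) + 1 \<le> \<bar>path_sum \<sigma> H (s @ y)\<bar>})" by blast
  moreover have "(0::real) < 1 / 2 ^ K" by simp
  ultimately show ?thesis by blast
qed

section \<open>Second moments and returns below the threshold\<close>

lemma powr_le_self:
  fixes x p :: real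
  assumes "1 \<le> x" "p \<le> 1"
  shows "x powr p \<le> x"
  using powr_mono[of p 1 x] assms by simp

text \<open>Here \<open>n - i - 1\<close> is at least \<open>n / 4\<close>, and the cell integral is
  at most 2 even for \<open>i = 1\<close>. The 8 is this 2 times
  \<open>4 powr (3/2 - H) \<le> 4\<close>.\<close>

lemma jH_upper_early:
  assumes "0 < \<sigma>" "1/2 < H" "H < 1" "4 \<le> n" "1 \<le> i" "2 * i \<le> n"
  shows "jH \<sigma> H n i \<le> 8 * (\<sigma> * CH H) * real n powr (2 * H - 2)"
proof -
  have "jH \<sigma> H n i \<le> \<sigma> * CH H * (real n powr (H - 1/2) * (real n - real i - 1) powr (H - 3/2) *
      integral {real i - 1..real i} (\<lambda>x. x powr (1/2 - H)))"
    using assms by (intro jH_upper_smooth) auto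
  also have "\<dots> \<le> \<sigma> * CH H * (real n powr (H - 1/2) * (real n / 4) powr (H - 3/2) * 2)"
    using assms CH_pos[of H] integral_powr_neg_cell_le(1)[of H i]
    by (intro mult_left_mono mult_mono powr_mono_neg integral_nonneg_total) auto
  also have "(real n / 4) powr (H - 3/2) = real n powr (H - 3/2) * 4 powr (3/2 - H)"
    using powr_minus_divide[of 4 "H - 3/2"] by (simp add: powr_divide)
  also have "\<sigma> * CH H * (real n powr (H - 1/2) * (real n powr (H - 3/2) * 4 powr (3/2 - H)) * 2) =
      2 * (4 powr (3/2 - H)) * (\<sigma> * CH H) * real n powr (2 * H - 2)"
  proof -
    have "real n powr (H - 1/2) * real n powr (H - 3/2) = real n powr (2 * H - 2)"
      unfolding powr_add[symmetric] by simp
    then show ?thesis by (simp only: mult_ac) (simp only: mult.assoc[symmetric])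
  qed
  also have "\<dots> \<le> 8 * (\<sigma> * CH H) * real n powr (2 * H - 2)"
    using powr_le_self[of 4 "3/2 - H"] CH_pos[of H] assms by (intro mult_right_mono) auto
  finally show ?thesis .
qed

text \<open>In the second half \<open>n / (i - 1)\<close> is at most 4, so only the distance to the
  diagonal matters.\<close>

lemma jH_upper_late:
  assumes "0 < \<sigma>" "1/2 < H" "H < 1" "4 \<le> n" "n < 2 * i" "i + 1 < n"
  shows "jH \<sigma> H n i \<le> 4 * (\<sigma> * CH H) * real (n - 1 - i) powr (H - 3/2)"
proof -
  have i: "2 \<le> i" "real n \<le> 4 * (real i - 1)" using assms by auto
  have "jH \<sigma> H n i \<le> \<sigma> * CH H * (real n powr (H - 1/2) * (real n - real i - 1) powr (H - 3/2) *
      integral {real i - 1..real i} (\<lambda>x. x powr (1/2 - H)))"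
    using assms i by (intro jH_upper_smooth) auto
  also have "\<dots> \<le> \<sigma> * CH H * (real n powr (H - 1/2) * (real n - real i - 1) powr (H - 3/2) *
      (real i - 1) powr (1/2 - H))"
    using assms CH_pos[of H] integral_powr_neg_cell_le(2)[of H i] i
    by (intro mult_left_mono) auto
  also have "\<dots> = \<sigma> * CH H * (real n / (real i - 1)) powr (H - 1/2) * real (n - 1 - i) powr (H - 3/2)"
    using i assms powr_minus_divide[of "real i - 1" "H - 1/2"] by (simp add: powr_divide of_nat_diff algebra_simps)
  also have "\<dots> \<le> \<sigma> * CH H * 4 * real (n - 1 - i) powr (H - 3/2)"
  proof (intro mult_right_mono mult_left_mono)
    have "(real n / (real i - 1)) powr (H - 1/2) \<le> real n / (real i - 1)"
      using i assms by (intro powr_le_self) (auto simp: field_simps)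
    also have "\<dots> \<le> 4" using i by (simp add: field_simps)
    finally show "(real n / (real i - 1)) powr (H - 1/2) \<le> 4" .
  qed (use CH_pos[of H] assms in auto)
  finally show ?thesis by (simp add: mult_ac)
qed

text \<open>The early squares are at most of order \<open>n powr (4 * H - 4)\<close>, with fewer
  than \<open>n\<close> of them, so \<open>H \<le> 3/4\<close> bounds their sum. The late ones form
  part of a series with exponent \<open>2 * H - 3 < -1\<close>.\<close>

lemma jH_sum_squares_bounded:
  assumes "0 < \<sigma>" "1/2 < H" "H \<le> 3/4"
  shows "\<exists>V. \<forall>n\<ge>4. (\<Sum>i<n - 2. (jH \<sigma> H n (Suc i))\<^sup>2) \<le> V"
proof -
  define D where "D = \<sigma> * CH H"
  have D: "0 < D" using CH_pos[of H] assms by (simp add: D_def)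
  define f where "f k = real k powr (2 * H - 3)" for k :: nat
  have f: "summable f" unfolding f_def using assms by (simp add: summable_real_powr_iff)
  have "(\<Sum>i<n - 2. (jH \<sigma> H n (Suc i))\<^sup>2) \<le> 64 * D\<^sup>2 + 16 * D\<^sup>2 * suminf f" if n: "4 \<le> n" for n
  proof -
    have "(\<Sum>i<n - 2. (jH \<sigma> H n (Suc i))\<^sup>2) \<le>
        (\<Sum>i<n - 2. 64 * D\<^sup>2 * real n powr (4 * H - 4) + 16 * D\<^sup>2 * f (n - 2 - i))"
    proof (rule sum_mono)
      fix i assume i: "i \<in> {..<n - 2}"
      have nn: "0 \<le> jH \<sigma> H n (Suc i)" using assms by (intro jH_nonneg) auto
      have f0: "0 \<le> f (n - 2 - i)" by (simp add: f_def)
      show "(jH \<sigma> H n (Suc i))\<^sup>2 \<le> 64 * D\<^sup>2 * real n powr (4 * H - 4) + 16 * D\<^sup>2 * f (n - 2 - i)"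
      proof (cases "2 * Suc i \<le> n")
        case True
        have "(jH \<sigma> H n (Suc i))\<^sup>2 \<le> (8 * D * real n powr (2 * H - 2))\<^sup>2"
          unfolding D_def using assms n True nn by (intro power_mono jH_upper_early) auto
        also have "\<dots> = 64 * D\<^sup>2 * (real n powr (2 * H - 2) * real n powr (2 * H - 2))"
          by (simp add: power2_eq_square)
        also have "\<dots> = 64 * D\<^sup>2 * real n powr (4 * H - 4)"
          unfolding powr_add[symmetric] by simp
        finally show ?thesis using f0 by (simp add: add_increasing2)
      next
        case False
        have "(jH \<sigma> H n (Suc i))\<^sup>2 \<le> (4 * D * real (n - 1 - Suc i) powr (H - 3/2))\<^sup>2"
          unfolding D_def using assms n False nn i by (intro power_mono jH_upper_late) auto
        also have "\<dots> = 16 * D\<^sup>2 * (real (n - 2 - i) powr (H - 3/2) * real (n - 2 - i) powr (H - 3/2))"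
          by (simp add: power2_eq_square)
        also have "\<dots> = 16 * D\<^sup>2 * f (n - 2 - i)"
          unfolding powr_add[symmetric] f_def by simp
        finally show ?thesis by (simp add: add_increasing)
      qed
    qed
    also have "\<dots> = 64 * D\<^sup>2 * (real (n - 2) * real n powr (4 * H - 4)) + 16 * D\<^sup>2 * (\<Sum>i<n - 2. f (n - 2 - i))"
      by (simp add: sum.distrib sum_distrib_left mult_ac)
    also have "\<dots> \<le> 64 * D\<^sup>2 * 1 + 16 * D\<^sup>2 * suminf f"
    proof (intro add_mono mult_left_mono)
      have "real (n - 2) * real n powr (4 * H - 4) \<le> real n powr 1 * real n powr (4 * H - 4)"
        using n by (intro mult_right_mono) auto
      also have "\<dots> = real n powr (4 * H - 3)" unfolding powr_add[symmetric] by simp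
      also have "\<dots> \<le> real n powr 0" using n assms by (intro powr_mono) auto
      finally show "real (n - 2) * real n powr (4 * H - 4) \<le> 1" using n by simp
      have "(\<Sum>i<n - 2. f (n - 2 - i)) = sum f ((\<lambda>i. n - 2 - i) ` {..<n - 2})"
        by (subst sum.reindex) (auto simp: inj_on_def)
      also have "\<dots> \<le> suminf f" using f by (intro sum_le_suminf) (auto simp: f_def)
      finally show "(\<Sum>i<n - 2. f (n - 2 - i)) \<le> suminf f" .
    qed auto
    finally show ?thesis by simp
  qed
  then show ?thesis by blast
qed

text \<open>This is where \<open>5/8\<close> comes from: with \<open>n / (i - 1) \<le> 3/2\<close>
  the coefficient is at most \<open>6 * \<sigma> * CH H\<close>, while
  \<open>(H - 1/2) * (H + 1/2) \<le> 9/64 < 1/6\<close> makes \<open>gH\<close> larger.\<close>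

lemma jH_le_gH:
  assumes "0 < \<sigma>" "1/2 < H" "H \<le> 5/8" "2 \<le> i" "i < n" "2 * real n \<le> 3 * (real i - 1)"
  shows "jH \<sigma> H n i \<le> gH \<sigma> H n"
proof -
  have "jH \<sigma> H n i \<le> \<sigma> * CH H * (4 * (real n / (real i - 1)) powr (H - 1/2))"
    using assms by (intro jH_upper_diagonal) auto
  also have "\<dots> \<le> \<sigma> * CH H * (1 / ((H - 1/2) * (H + 1/2)))"
  proof (rule mult_left_mono)
    have "(real n / (real i - 1)) powr (H - 1/2) \<le> real n / (real i - 1)"
      using assms by (intro powr_le_self) (auto simp: field_simps)
    also have "\<dots> \<le> 3/2" using assms by (simp add: field_simps)
    finally have "4 * (real n / (real i - 1)) powr (H - 1/2) \<le> 6" by simp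
    also have "6 \<le> 1 / ((H - 1/2) * (H + 1/2))"
    proof -
      have "(H - 1/2) * (H + 1/2) \<le> 1/8 * (9/8)" using assms by (intro mult_mono) auto
      moreover have "0 < (H - 1/2) * (H + 1/2)" using assms by (intro mult_pos_pos) auto
      ultimately show ?thesis by (simp add: field_simps)
    qed
    finally show "4 * (real n / (real i - 1)) powr (H - 1/2) \<le> 1 / ((H - 1/2) * (H + 1/2))" .
  qed (use CH_pos[of H] assms in auto)
  also have "\<dots> \<le> gH \<sigma> H n" using assms by (intro gH_lower) auto
  finally show ?thesis .
qed

text \<open>The sum is split into the given prefix, made harmless by a late final time,
  \<open>r\<close> middle signs controlled by Chebyshev, and \<open>K\<close> last signs chosen
  greedily. Half of the middle parts, each with at least one of \<open>2 ^ K\<close> endings, give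
  \<open>d = 1 / 2 ^ (K + 1)\<close>.\<close>

lemma path_sum_small_hits:
  assumes "0 < \<sigma>" "1/2 < H" "H \<le> 5/8"
  shows "\<exists>d>0. \<forall>m. \<exists>k. \<forall>s\<in>signs m. d * 2 ^ k \<le>
    real (card {y \<in> signs k. \<bar>path_sum \<sigma> H (s @ y)\<bar> \<le> gH \<sigma> H (Suc (length (s @ y)))})"
proof -
  define D where "D = \<sigma> * CH H"
  have D: "0 < D" using CH_pos[of H] assms by (simp add: D_def)
  obtain V where V: "\<And>n. 4 \<le> n \<Longrightarrow> (\<Sum>i<n - 2. (jH \<sigma> H n (Suc i))\<^sup>2) \<le> V"
    using jH_sum_squares_bounded[of \<sigma> H] assms by auto
  have "0 \<le> (\<Sum>i<4 - 2. (jH \<sigma> H 4 (Suc i))\<^sup>2)" by (intro sum_nonneg) auto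
  also have "\<dots> \<le> V" by (rule V) simp
  finally have "0 \<le> V" .
  \<comment> \<open>The prefix contributes at most \<open>8 * D\<close>, the middle has variance at
    most \<open>V\<close>, and the 2 is the one required by \<open>wsum_chebyshev\<close>.\<close>
  define C where "C = sqrt (2 * (64 * D\<^sup>2 + V))"
  have C: "0 < C" "C\<^sup>2 = 2 * (64 * D\<^sup>2 + V)"
    using D \<open>0 \<le> V\<close> by (auto simp: C_def add_pos_nonneg)
  obtain K where K: "2 \<le> K" "\<And>N. C \<le> (\<Sum>l<K. jH \<sigma> H (Suc (N + K)) (Suc (N + l)))"
    using jH_block_sum_unbounded[of \<sigma> H C] assms by auto
  have "\<exists>k. \<forall>s\<in>signs m. 1 / 2 ^ (K + 1) * 2 ^ k \<le>
    real (card {y \<in> signs k. \<bar>path_sum \<sigma> H (s @ y)\<bar> \<le> gH \<sigma> H (Suc (length (s @ y)))})" for m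
  proof -
    \<comment> \<open>The term \<open>m * m\<close> makes \<open>m \<le> sqrt n\<close>,
      \<open>m\<close> puts the prefix into the first half, and \<open>2 * K + 4\<close> brings the
      last \<open>K\<close> indices close enough to the diagonal for
      \<open>jH_le_gH\<close>.\<close>
    define r where "r = m * m + m + 2 * K + 4"
    define n where "n = Suc (m + r + K)"
    let ?b = "\<lambda>i. jH \<sigma> H n (Suc i)"
    have n4: "4 \<le> n" by (simp add: n_def r_def)
    have step: "?b (m + r + l) \<le> gH \<sigma> H n" if "l < K" for l
      using assms that by (intro jH_le_gH) (auto simp: n_def r_def)
    have "1 / 2 ^ (K + 1) * 2 ^ (r + K) \<le>
        real (card {y \<in> signs (r + K). \<bar>path_sum \<sigma> H (s @ y)\<bar> \<le> gH \<sigma> H (Suc (length (s @ y)))})"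
      (is "_ \<le> real (card ?A)") if s: "s \<in> signs m" for s
    proof -
      define c where "c = wsum ?b s"
      have len: "length s = m" using s by (rule length_signs)
      have "\<bar>c\<bar> \<le> (\<Sum>i<m. ?b i)"
        unfolding c_def using s jH_nonneg assms by (intro abs_wsum_le) auto
      also have "\<dots> \<le> (\<Sum>i<m. 8 * D * real n powr (2 * H - 2))"
        unfolding D_def using assms n4 by (intro sum_mono jH_upper_early) (auto simp: n_def r_def)
      also have "\<dots> = 8 * D * (real m * real n powr (2 * H - 2))" by simp
      also have "\<dots> \<le> 8 * D * 1"
      proof (intro mult_left_mono)
        have "real m = sqrt (real (m * m))" by simp
        also have "\<dots> \<le> sqrt (real n)"
          by (intro real_sqrt_le_mono) (simp add: n_def r_def)
        also have "\<dots> = real n powr (1/2)" by (simp add: powr_half_sqrt)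
        finally have "real m * real n powr (2 * H - 2) \<le> real n powr (1/2) * real n powr (2 * H - 2)"
          by (intro mult_right_mono) auto
        also have "\<dots> = real n powr (2 * H - 3/2)" unfolding powr_add[symmetric] by simp
        also have "\<dots> \<le> real n powr 0" using n4 assms by (intro powr_mono) auto
        finally show "real m * real n powr (2 * H - 2) \<le> 1" using n4 by simp
      qed (use D in auto)
      finally have "c\<^sup>2 \<le> (8 * D)\<^sup>2" using D by (intro abs_le_square_iff[THEN iffD1]) auto
      then have c2: "c\<^sup>2 \<le> 64 * D\<^sup>2" by (simp add: power_mult_distrib)
      have "(\<Sum>i<r. (?b (m + i))\<^sup>2) = (\<Sum>i\<in>(\<lambda>i. m + i) ` {..<r}. (?b i)\<^sup>2)"
        by (subst sum.reindex) (auto simp: inj_on_def)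
      also have "\<dots> \<le> (\<Sum>i<n - 2. (?b i)\<^sup>2)"
        using K(1) by (intro sum_mono2) (auto simp: n_def)
      also have "\<dots> \<le> V" by (rule V[OF n4])
      finally have "2 * (c\<^sup>2 + (\<Sum>i<r. (?b (m + i))\<^sup>2)) \<le> C\<^sup>2"
        using c2 C(2) by simp
      from wsum_chebyshev[OF this C(1)]
      have good: "2 ^ r / 2 \<le> real (card {z \<in> signs r. \<bar>c + wsum (\<lambda>i. ?b (m + i)) z\<bar> \<le> C})"
        (is "_ \<le> real (card ?Z)") .
      have "\<exists>w\<in>signs K. z @ w \<in> ?A" if z: "z \<in> ?Z" for z
      proof -
        let ?c = "c + wsum (\<lambda>i. ?b (m + i)) z"
        obtain w where w: "w \<in> signs K"
            "\<bar>?c + wsum (\<lambda>l. ?b (m + r + l)) w\<bar> \<le> max (gH \<sigma> H n) (\<bar>?c\<bar> - (\<Sum>l<K. ?b (m + r + l)))"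
          using greedy_signs[of K "\<lambda>l. ?b (m + r + l)" "gH \<sigma> H n" ?c] step jH_nonneg assms by auto
        \<comment> \<open>The block outweighs \<open>?c\<close>, so the second argument of the
          maximum is at most 0 and \<open>gH\<close> remains.\<close>
        have "C \<le> (\<Sum>l<K. ?b (m + r + l))" using K(2)[of "m + r"] by (simp add: n_def)
        moreover have "0 \<le> gH \<sigma> H n"
          using order_trans[OF jH_nonneg step[of 0]] K(1) assms by simp
        ultimately have le: "\<bar>?c + wsum (\<lambda>l. ?b (m + r + l)) w\<bar> \<le> gH \<sigma> H n"
          using w(2) z by auto
        have lens: "length z = r" "length w = K" using z w(1) length_signs by auto
        have "path_sum \<sigma> H (s @ z @ w) = ?c + wsum (\<lambda>l. ?b (m + r + l)) w"
          by (simp add: path_sum_def wsum_append len lens c_def n_def add_ac)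
        moreover have "z @ w \<in> signs (r + K)" using z w(1) by (auto intro: append_in_signs)
        ultimately have "z @ w \<in> ?A"
          using le len lens by (simp add: n_def add.assoc)
        then show ?thesis using w(1) by blast
      qed
      then have "\<forall>z\<in>?Z. \<exists>w. z @ w \<in> ?A" by blast
      then obtain W where W: "\<forall>z\<in>?Z. z @ W z \<in> ?A" by (rule bchoice[elim_format]) blast
      \<comment> \<open>All \<open>z\<close> have the same length, so they can be read off from
        their extensions and \<open>?A\<close> is at least as large as \<open>?Z\<close>.\<close>
      have "inj_on (\<lambda>z. z @ W z) ?Z"
      proof (rule inj_onI)
        fix z z' assume zz: "z \<in> ?Z" "z' \<in> ?Z" "z @ W z = z' @ W z'"
        then have "length z = length z'" by (auto simp: signs_def)
        then show "z = z'" using zz(3) by simp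
      qed
      moreover have "(\<lambda>z. z @ W z) ` ?Z \<subseteq> ?A" using W by blast
      ultimately have "card ?Z \<le> card ?A" by (intro card_inj_on_le) auto
      then have "2 ^ r / 2 \<le> real (card ?A)" using good by linarith
      then show ?thesis by (simp add: power_add)
    qed
    then show ?thesis by blast
  qed
  moreover have "(0::real) < 1 / 2 ^ (K + 1)" by simp
  ultimately show ?thesis by blast
qed

section \<open>Scaling of the market quantities\<close>

lemma integrable_kernel:
  fixes H s t :: real
  assumes "1/2 < H" "H < 1" "0 \<le> s"
  shows "(\<lambda>w. w powr (H - 1/2) * (w - s) powr (H - 3/2)) integrable_on {s..t}"
proof (cases "s \<le> t")
  case True
  have "(\<lambda>w. (w - s) powr (H - 3/2)) integrable_on {s..t}"
    using has_integral_powr_shift[of "H - 3/2" s t] True assms by auto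
  then show ?thesis
    using assms by (intro integrable_mono_times[where g = "\<lambda>w. w powr (H - 1/2)"] powr_mono2) auto
qed (simp add: integrable_on_empty not_le)

lemma powr_rescale:
  fixes N H x y :: real
  assumes "0 < N" "0 \<le> x"
  shows "(x / N) powr (1/2 - H) * (N powr (1 - 2 * H) * y) = N powr (1/2 - H) * (x powr (1/2 - H) * y)"
proof -
  have "(x / N) powr (1/2 - H) = N powr (H - 1/2) * x powr (1/2 - H)"
    using assms powr_minus_divide[of N "1/2 - H"] by (simp add: powr_divide)
  moreover have "N powr (H - 1/2) * N powr (1 - 2 * H) = N powr (1/2 - H)"
    unfolding powr_add[symmetric] by simp
  ultimately show ?thesis by (simp add: mult_ac)
qed

lemma powr_rescale_total:
  fixes N H :: real
  assumes "0 < N"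
  shows "sqrt N * (N powr (1/2 - H) / N) = N powr (- H)"
proof -
  have "sqrt N * (N powr (1/2 - H) / N) = N powr (1/2) * (N powr (1/2 - H) * N powr (-1))"
    using assms by (simp add: powr_half_sqrt powr_minus_divide)
  also have "\<dots> = N powr (- H)" unfolding powr_add[symmetric] by simp
  finally show ?thesis .
qed

lemma kernel_rescale:
  fixes N H p q :: real
  assumes "0 < N" "0 \<le> p" "0 \<le> q"
  shows "(p / N) powr (H - 1/2) * (q / N) powr (H - 3/2) =
    N powr (2 - 2 * H) * (p powr (H - 1/2) * q powr (H - 3/2))"
proof -
  have "(p / N) powr (H - 1/2) * (q / N) powr (H - 3/2) =
      (N powr (1/2 - H) * N powr (3/2 - H)) * (p powr (H - 1/2) * q powr (H - 3/2))"
    using assms powr_minus_divide[of N "H - 1/2"] powr_minus_divide[of N "H - 3/2"]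
    by (simp add: powr_divide)
  also have "N powr (1/2 - H) * N powr (3/2 - H) = N powr (2 - 2 * H)"
    unfolding powr_add[symmetric] by simp
  finally show ?thesis .
qed

text \<open>The exponent of \<open>N\<close> is 1/2 from the normalisation, -1 from the substitution
  \<open>u = x / N\<close> and \<open>1/2 - H\<close> from the kernel, in total
  \<open>- H\<close>.\<close>

lemma integral_cell_rescale:
  fixes N :: real
  assumes "0 < N" "\<And>x. a \<le> x \<Longrightarrow> x \<le> b \<Longrightarrow> f (x / N) = c * N powr (1/2 - H) * F x"
  shows "\<sigma> * sqrt N * integral {a / N..b / N} f = N powr (- H) * (\<sigma> * c * integral {a..b} F)"
proof -
  have "integral {a / N..b / N} f = integral {a / N..b / N} (\<lambda>u. c * N powr (1/2 - H) * F (N * u))"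
  proof (rule integral_cong)
    fix u assume "u \<in> {a / N..b / N}"
    then have "a \<le> N * u" "N * u \<le> b" using assms(1) by (auto simp: field_simps)
    then show "f u = c * N powr (1/2 - H) * F (N * u)"
      using assms(2)[of "N * u"] assms(1) by simp
  qed
  also have "\<dots> = c * N powr (1/2 - H) * (integral {a..b} F / N)"
    using integral_affine_real[OF assms(1), of a 0 b F] by simp
  finally have "\<sigma> * sqrt N * integral {a / N..b / N} f =
      (sqrt N * (N powr (1/2 - H) / N)) * (\<sigma> * c * integral {a..b} F)" by simp
  then show ?thesis unfolding powr_rescale_total[OF assms(1)] .
qed

text \<open>The singularity at \<open>s\<close> is integrable, so the two kernel integrals can be
  subtracted. The remaining stretch is parametrised by \<open>w = (v + n - 1) / N\<close> with
  \<open>v\<close> in the unit interval.\<close>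

lemma JN_eq_jH:
  assumes "1/2 < H" "H < 1" "0 < N" "1 \<le> i" "i < n"
  shows "JN \<sigma> H N n i = real N powr (- H) * jH \<sigma> H n i"
  unfolding JN_def jH_def
proof (rule integral_cell_rescale)
  let ?G = "\<lambda>x. integral {0..1} (\<lambda>v. (v + real n - 1) powr (H - 1/2) * (v + real n - 1 - x) powr (H - 3/2))"
  show N: "0 < real N" using assms by simp
  fix x assume x: "real i - 1 \<le> x" "x \<le> real i"
  define s where "s = x / real N"
  define f where "f w = w powr (H - 1/2) * (w - s) powr (H - 3/2)" for w
  have s: "0 \<le> s" "s \<le> (real n - 1) / real N" "(real n - 1) / real N \<le> real n / real N"
    using x assms N by (auto simp: s_def divide_right_mono)
  have "f integrable_on {s..real n / real N}"
    unfolding f_def by (rule integrable_kernel) (use assms s in auto)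
  then have diff: "integral {s..real n / real N} f - integral {s..(real n - 1) / real N} f =
      integral {(real n - 1) / real N..real n / real N} f"
    using Henstock_Kurzweil_Integration.integral_combine[of s "(real n - 1) / real N" "real n / real N" f] s by simp
  have "integral {(real n - 1) / real N..real n / real N} f =
      integral {0..1} (\<lambda>v. f (1 / real N * v + (real n - 1) / real N)) / real N"
    using integral_affine_real[of "1 / real N" "(real n - 1) / real N" "(real n - 1) / real N" "real n / real N" f] N
    by (simp add: diff_divide_distrib)
  also have "integral {0..1} (\<lambda>v. f (1 / real N * v + (real n - 1) / real N)) =
      integral {0..1} (\<lambda>v. real N powr (2 - 2 * H) *
        ((v + real n - 1) powr (H - 1/2) * (v + real n - 1 - x) powr (H - 3/2)))"
  proof (rule integral_cong)
    fix v :: real assume v: "v \<in> {0..1}"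
    have "f (1 / real N * v + (real n - 1) / real N) =
        ((v + real n - 1) / real N) powr (H - 1/2) * ((v + real n - 1 - x) / real N) powr (H - 3/2)"
      by (simp add: f_def s_def add_divide_distrib diff_divide_distrib add_diff_eq)
    also have "\<dots> = real N powr (2 - 2 * H) *
        ((v + real n - 1) powr (H - 1/2) * (v + real n - 1 - x) powr (H - 3/2))"
      using N v x assms by (intro kernel_rescale) auto
    finally show "f (1 / real N * v + (real n - 1) / real N) = real N powr (2 - 2 * H) *
        ((v + real n - 1) powr (H - 1/2) * (v + real n - 1 - x) powr (H - 3/2))" .
  qed
  also have "\<dots> / real N = real N powr (1 - 2 * H) * ?G x"
    using N powr_diff[of "real N" "2 - 2 * H" 1] by simp
  finally have "kH H (real n / real N) s - kH H ((real n - 1) / real N) s =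
      CH H * (s powr (1/2 - H) * (real N powr (1 - 2 * H) * ?G x))"
    unfolding kH_def f_def[symmetric] using diff by (simp add: right_diff_distrib[symmetric] mult.assoc)
  also have "\<dots> = CH H * (real N powr (1/2 - H) * (x powr (1/2 - H) * ?G x))"
    unfolding s_def using N x assms by (subst powr_rescale) auto
  finally show "kH H (real n / real N) (x / real N) - kH H ((real n - 1) / real N) (x / real N) =
      CH H * real N powr (1/2 - H) * (x powr (1/2 - H) * ?G x)"
    by (simp add: s_def mult.assoc)
qed

text \<open>The map \<open>w = m * y + s\<close> with \<open>m = (n - x) / N\<close> carries the
  unit interval onto the range from \<open>s\<close> to \<open>n / N\<close>. For
  \<open>x = n\<close> it degenerates, and both sides vanish.\<close>

lemma gN_eq_gH:
  assumes "1/2 < H" "H < 1" "0 < N" "1 \<le> n"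
  shows "gN \<sigma> H N n = real N powr (- H) * gH \<sigma> H n"
  unfolding gN_def gH_def
proof (rule integral_cell_rescale)
  let ?G = "\<lambda>x. integral {0..1} (\<lambda>y. (y * (real n - x) + x) powr (H - 1/2) * y powr (H - 3/2))"
  show N: "0 < real N" using assms by simp
  fix x assume x: "real n - 1 \<le> x" "x \<le> real n"
  define s where "s = x / real N"
  define f where "f w = w powr (H - 1/2) * (w - s) powr (H - 3/2)" for w
  have "integral {s..real n / real N} f = real N powr (1 - 2 * H) * ((real n - x) powr (H - 1/2) * ?G x)"
  proof (cases "x = real n")
    case True
    then show ?thesis by (simp add: s_def)
  next
    case False
    define m where "m = (real n - x) / real N"
    have m: "0 < m" using False x N by (simp add: m_def)
    have "(real n / real N - s) / m = 1"
      using False N by (simp add: m_def s_def diff_divide_distrib[symmetric])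
    then have "integral {s..real n / real N} f = m * integral {0..1} (\<lambda>y. f (m * y + s))"
      using integral_affine_real[OF m, of s s "real n / real N" f] m by simp
    also have "integral {0..1} (\<lambda>y. f (m * y + s)) =
        integral {0..1} (\<lambda>y. real N powr (2 - 2 * H) * (real n - x) powr (H - 3/2) *
          ((y * (real n - x) + x) powr (H - 1/2) * y powr (H - 3/2)))"
    proof (rule integral_cong)
      fix y :: real assume y: "y \<in> {0..1}"
      have "f (m * y + s) = ((y * (real n - x) + x) / real N) powr (H - 1/2) *
          (y * (real n - x) / real N) powr (H - 3/2)"
        by (simp add: f_def s_def m_def add_divide_distrib mult.commute)
      also have "\<dots> = real N powr (2 - 2 * H) *
          ((y * (real n - x) + x) powr (H - 1/2) * (y * (real n - x)) powr (H - 3/2))"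
        using N y x assms by (intro kernel_rescale add_nonneg_nonneg mult_nonneg_nonneg) auto
      also have "(y * (real n - x)) powr (H - 3/2) = y powr (H - 3/2) * (real n - x) powr (H - 3/2)"
        by (rule powr_mult)
      finally show "f (m * y + s) = real N powr (2 - 2 * H) * (real n - x) powr (H - 3/2) *
          ((y * (real n - x) + x) powr (H - 1/2) * y powr (H - 3/2))" by (simp add: mult_ac)
    qed
    also have "m * \<dots> = (real N powr (2 - 2 * H) / real N) * ((real n - x) * (real n - x) powr (H - 3/2)) * ?G x"
      by (simp add: m_def)
    also have "real N powr (2 - 2 * H) / real N = real N powr (1 - 2 * H)"
      using N powr_diff[of "real N" "2 - 2 * H" 1] by simp
    also have "(real n - x) * (real n - x) powr (H - 3/2) = (real n - x) powr (H - 1/2)"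
      using x powr_add[of "real n - x" 1 "H - 3/2"] by simp
    finally show ?thesis by simp
  qed
  then have "kH H (real n / real N) s =
      CH H * (s powr (1/2 - H) * (real N powr (1 - 2 * H) * ((real n - x) powr (H - 1/2) * ?G x)))"
    unfolding kH_def f_def[symmetric] by (simp add: mult.assoc)
  also have "\<dots> = CH H * (real N powr (1/2 - H) * (x powr (1/2 - H) * ((real n - x) powr (H - 1/2) * ?G x)))"
    unfolding s_def using N x assms by (subst powr_rescale) auto
  finally show "kH H (real n / real N) (x / real N) =
      CH H * real N powr (1/2 - H) * (x powr (1/2 - H) * (real n - x) powr (H - 1/2) * ?G x)"
    by (simp add: s_def mult.assoc)
qed

section \<open>Arbitrage paths of the market\<close>

lemma YN_eq_path_sum:
  assumes "1/2 < H" "H < 1" "0 < N"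
  shows "YN \<sigma> H N (Suc (length x)) x = real N powr (- H) * path_sum \<sigma> H x"
proof -
  have "YN \<sigma> H N (Suc (length x)) x = (\<Sum>i<length x. JN \<sigma> H N (Suc (length x)) (Suc i) * x ! i)"
    by (simp add: YN_def sum.atLeast1_atMost_eq)
  also have "\<dots> = (\<Sum>i<length x. real N powr (- H) * (jH \<sigma> H (Suc (length x)) (Suc i) * x ! i))"
    using assms by (intro sum.cong) (auto simp: JN_eq_jH)
  finally show ?thesis by (simp add: path_sum_def wsum_def sum_distrib_left)
qed

lemma YH_eq_path_sum: "YH \<sigma> H (Suc n) \<omega> = path_sum \<sigma> H (map \<omega> [1..<Suc n])"
  by (simp add: YH_def path_sum_def wsum_def sum.atLeast1_atMost_eq del: upt_Suc)

lemma measurable_YH [measurable]: "YH \<sigma> H n \<in> borel_measurable Rad"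
  unfolding YH_def[abs_def] by measurable

text \<open>In units of \<open>N powr (- H)\<close> the drift is at most
  \<open>A * N powr (H - 1) \<le> 1\<close>, which the margin above \<open>gH\<close> absorbs. The
  sign of the path sum decides which of the two arbitrage conditions holds.\<close>

lemma large_path_in_AP:
  assumes H: "1/2 < H" "H < 1" and a: "\<And>t. t \<in> {0..1} \<Longrightarrow> \<bar>a t\<bar> \<le> A"
    and N: "0 < N" "A * real N powr (H - 1) \<le> 1"
    and x: "x \<in> signs (N - 1)" and m: "m \<le> N - 1"
    and large: "gH \<sigma> H (Suc (length (take m x))) + 1 \<le> \<bar>path_sum \<sigma> H (take m x)\<bar>"
  shows "x \<in> AP \<sigma> a H N"
proof -
  define y where "y = take m x"
  have len: "length y = m" using x m by (simp add: y_def signs_def)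
  define c where "c = real N powr (- H)"
  have c: "0 < c" using N by (simp add: c_def)
  have "c * (A * real N powr (H - 1)) \<le> c * 1" using N c by (intro mult_left_mono) auto
  moreover have "c * (A * real N powr (H - 1)) = A / real N"
  proof -
    have "c * real N powr (H - 1) = real N powr (-1)"
      unfolding c_def powr_add[symmetric] by simp
    then show ?thesis using N(1) by (simp add: powr_minus_divide mult.left_commute)
  qed
  moreover have "\<bar>aN a N (Suc m)\<bar> \<le> A / real N"
    unfolding aN_def abs_divide using a[of "real (Suc m) / real N"] m N(1)
    by (simp add: divide_right_mono)
  ultimately have ac: "\<bar>aN a N (Suc m)\<bar> \<le> c" by linarith
  have Y: "YN \<sigma> H N (Suc m) y = c * path_sum \<sigma> H y"
    using YN_eq_path_sum[OF H N(1), of \<sigma> y] len by (simp add: c_def)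
  have g: "gN \<sigma> H N (Suc m) = c * gH \<sigma> H (Suc m)"
    using H N by (simp add: gN_eq_gH c_def)
  have "gH \<sigma> H (Suc m) + 1 \<le> path_sum \<sigma> H y \<or> path_sum \<sigma> H y \<le> - (gH \<sigma> H (Suc m) + 1)"
    using large len by (auto simp: y_def[symmetric])
  then have "uN \<sigma> H N (Suc m) y \<le> - aN a N (Suc m) \<or> dN \<sigma> H N (Suc m) y \<ge> - aN a N (Suc m)"
  proof
    assume "gH \<sigma> H (Suc m) + 1 \<le> path_sum \<sigma> H y"
    from mult_left_mono[OF this, of c] c have "c * gH \<sigma> H (Suc m) + c \<le> c * path_sum \<sigma> H y"
      by (simp add: distrib_left)
    then show ?thesis using ac unfolding dN_def Y g by linarith
  next
    assume "path_sum \<sigma> H y \<le> - (gH \<sigma> H (Suc m) + 1)"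
    from mult_left_mono[OF this, of c] c have "c * path_sum \<sigma> H y \<le> - (c * gH \<sigma> H (Suc m)) - c"
      by (simp add: algebra_simps)
    then show ?thesis using ac unfolding uN_def Y g by linarith
  qed
  moreover have "set y \<subseteq> {-1, 1}"
    using x set_take_subset[of m x] by (auto simp: y_def signs_def)
  ultimately have "take (Suc m - 1) x \<in> An \<sigma> a H N (Suc m)"
    using len by (simp add: An_def y_def)
  moreover have "Suc m \<in> {1..N}" using m N(1) by auto
  ultimately show ?thesis using x unfolding AP_def signs_def by blast
qed

text \<open>For large \<open>N\<close> every path that does not avoid the large values is an
  arbitrage path, and the avoiding fraction tends to 0.\<close>

lemma card_AP_fraction_tendsto_1:
  assumes "1/2 < H" "H < 1" "continuous_on {0..1} a"
    and lim: "(\<lambda>N. real (card (avoiding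
      (\<lambda>x. gH \<sigma> H (Suc (length x)) + 1 \<le> \<bar>path_sum \<sigma> H x\<bar>) 1 N)) / 2 ^ N) \<longlonglongrightarrow> 0"
      (is "(\<lambda>N. real (card (avoiding ?B 1 N)) / 2 ^ N) \<longlonglongrightarrow> 0")
  shows "(\<lambda>N. real (card (AP \<sigma> a H N)) / 2 ^ (N - 1)) \<longlonglongrightarrow> 1"
proof -
  have "compact (a ` {0..1})" using assms(3) by (intro compact_continuous_image) auto
  from compact_imp_bounded[OF this] obtain A where A: "\<forall>t\<in>{0..1}. \<bar>a t\<bar> \<le> A"
    unfolding bounded_iff by auto
  have sub: "AP \<sigma> a H N \<subseteq> signs (N - 1)" for N by (auto simp: AP_def signs_def)
  have "(\<lambda>N. A * real N powr (H - 1)) \<longlonglongrightarrow> A * 0"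
    using assms by (intro tendsto_mult tendsto_const tendsto_neg_powr filterlim_real_sequentially) auto
  then have "\<forall>\<^sub>F N in sequentially. A * real N powr (H - 1) < 1"
    by (rule order_tendstoD(2)) simp
  then have low: "\<forall>\<^sub>F N in sequentially.
      1 - real (card (avoiding ?B 1 (N - 1))) / 2 ^ (N - 1) \<le> real (card (AP \<sigma> a H N)) / 2 ^ (N - 1)"
    using eventually_gt_at_top[of 0]
  proof eventually_elim
    case (elim N)
    have "signs (N - 1) - avoiding ?B 1 (N - 1) \<subseteq> AP \<sigma> a H N"
    proof
      fix x assume x: "x \<in> signs (N - 1) - avoiding ?B 1 (N - 1)"
      \<comment> \<open>A prefix of length \<open>m\<close> decides time \<open>m + 1\<close>, so
        the lengths up to \<open>N - 1\<close> match the times up to \<open>N\<close>.\<close>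
      then obtain m where "m \<le> N - 1" "?B (take m x)" by (auto simp: avoiding_def)
      then show "x \<in> AP \<sigma> a H N"
        using assms(1,2) A elim x by (intro large_path_in_AP[where m = m and A = A]) (simp_all del: length_take)
    qed
    then have "card (signs (N - 1) - avoiding ?B 1 (N - 1)) \<le> card (AP \<sigma> a H N)"
      by (rule card_mono[OF finite_subset[OF sub finite_signs]])
    moreover have "avoiding ?B 1 (N - 1) \<subseteq> signs (N - 1)" by (auto simp: avoiding_def)
    ultimately have "card (signs (N - 1)) - card (avoiding ?B 1 (N - 1)) \<le> card (AP \<sigma> a H N)"
      using card_Diff_subset[OF finite_subset[OF _ finite_signs], of "avoiding ?B 1 (N - 1)" "N - 1"] by simp
    then have "real (card (signs (N - 1))) - real (card (avoiding ?B 1 (N - 1))) \<le> real (card (AP \<sigma> a H N))"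
      by linarith
    then have "2 ^ (N - 1) - real (card (avoiding ?B 1 (N - 1))) \<le> real (card (AP \<sigma> a H N))"
      by (simp add: card_signs)
    from divide_right_mono[OF this, of "2 ^ (N - 1)"] show ?case by (simp add: diff_divide_distrib)
  qed
  have up: "real (card (AP \<sigma> a H N)) / 2 ^ (N - 1) \<le> 1" for N
    using card_mono[OF _ sub[of N]] by (simp add: card_signs)
  have "(\<lambda>N. 1 - real (card (avoiding ?B 1 (N - 1))) / 2 ^ (N - 1)) \<longlonglongrightarrow> 1 - 0"
  proof (intro tendsto_diff tendsto_const)
    show "(\<lambda>N. real (card (avoiding ?B 1 (N - 1))) / 2 ^ (N - 1)) \<longlonglongrightarrow> 0"
      using lim by (subst filterlim_sequentially_Suc[symmetric]) simp
  qed
  then show ?thesis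
    using up by (intro tendsto_sandwich[OF low _ _ tendsto_const]) auto
qed

theorem theorem3p5:
  fixes \<sigma> :: real and a :: "real \<Rightarrow> real"
  assumes "\<sigma> > 0" and "continuous_on {0..1} a"
  shows "\<exists>Hc. 1/2 < Hc \<and> Hc < 1 \<and>
    (\<forall>H. Hc < H \<and> H < 1 \<longrightarrow>
       measure Rad {\<omega> \<in> space Rad. \<forall>n\<ge>1. \<exists>k\<ge>n. \<bar>YH \<sigma> H k \<omega>\<bar> > gH \<sigma> H k} = 1) \<and>
    (\<forall>H. 1/2 < H \<and> H < Hc \<longrightarrow>
       measure Rad {\<omega> \<in> space Rad. \<exists>n\<ge>1. \<forall>k\<ge>n. \<bar>YH \<sigma> H k \<omega>\<bar> > gH \<sigma> H k} = 0) \<and>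
    (\<forall>H. Hc < H \<and> H < 1 \<longrightarrow>
       (\<lambda>N. real (card (AP \<sigma> a H N)) / 2 ^ (N - 1)) \<longlonglongrightarrow> 1)"
proof -
  \<comment> \<open>The margin 1 serves twice: \<open>io\<close> reads it as a strict inequality,
    and \<open>AP\<close> spends it on the drift.\<close>
  have large: "(\<lambda>N. real (card (avoiding
      (\<lambda>x. gH \<sigma> H (Suc (length x)) + 1 \<le> \<bar>path_sum \<sigma> H x\<bar>) m N)) / 2 ^ N) \<longlonglongrightarrow> 0"
    if H: "1/2 < H" "H < 1" and m: "1 \<le> m" for H m
  proof -
    obtain d where d: "0 < d" "\<forall>N\<ge>1. \<exists>k. \<forall>s\<in>signs N. d * 2 ^ k \<le>
        real (card {y \<in> signs k. gH \<sigma> H (Suc (length (s @ y))) + 1 \<le> \<bar>path_sum \<sigma> H (s @ y)\<bar>})"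
      using path_sum_large_hits[OF assms(1) H] by (elim exE conjE) rule
    show ?thesis
      by (rule avoiding_fraction_tendsto_0[OF d(1)]) (rule d(2)[rule_format], use m in simp)
  qed
  have io: "measure Rad {\<omega> \<in> space Rad. \<forall>n\<ge>1. \<exists>k\<ge>n. \<bar>YH \<sigma> H k \<omega>\<bar> > gH \<sigma> H k} = 1"
    if H: "1/2 < H" "H < 1" for H
  proof -
    have "AE \<omega> in Rad. \<forall>n. 1 \<le> n \<longrightarrow> (\<exists>k\<ge>n. \<bar>YH \<sigma> H k \<omega>\<bar> > gH \<sigma> H k)"
      unfolding AE_all_countable
    proof (intro allI AE_impI)
      fix n :: nat assume "1 \<le> n"
      from AE_Rad_hits[OF large[OF H this]]
      show "AE \<omega> in Rad. \<exists>k\<ge>n. \<bar>YH \<sigma> H k \<omega>\<bar> > gH \<sigma> H k"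
      proof eventually_elim
        case (elim \<omega>)
        then obtain k where "n \<le> k" "gH \<sigma> H (Suc k) + 1 \<le> \<bar>YH \<sigma> H (Suc k) \<omega>\<bar>"
          unfolding YH_eq_path_sum by (simp del: upt_Suc) blast
        then show ?case by (intro exI[of _ "Suc k"]) auto
      qed
    qed
    then show ?thesis by (subst Rad.prob_Collect_eq_1) measurable
  qed
  have ult: "measure Rad {\<omega> \<in> space Rad. \<exists>n\<ge>1. \<forall>k\<ge>n. \<bar>YH \<sigma> H k \<omega>\<bar> > gH \<sigma> H k} = 0"
    if H: "1/2 < H" "H < 5/8" for H
  proof -
    obtain d where d: "0 < d" "\<forall>m. \<exists>k. \<forall>s\<in>signs m. d * 2 ^ k \<le>
        real (card {y \<in> signs k. \<bar>path_sum \<sigma> H (s @ y)\<bar> \<le> gH \<sigma> H (Suc (length (s @ y)))})"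
      using path_sum_small_hits[OF assms(1) H(1) less_imp_le[OF H(2)]] by (elim exE conjE) rule
    have small: "(\<lambda>N. real (card (avoiding
        (\<lambda>x. \<bar>path_sum \<sigma> H x\<bar> \<le> gH \<sigma> H (Suc (length x))) m N)) / 2 ^ N) \<longlonglongrightarrow> 0" for m
      by (rule avoiding_fraction_tendsto_0[OF d(1)]) (rule d(2)[rule_format])
    have "AE \<omega> in Rad. \<forall>n. \<exists>k\<ge>n. \<bar>YH \<sigma> H k \<omega>\<bar> \<le> gH \<sigma> H k"
      unfolding AE_all_countable
    proof
      fix n :: nat
      from AE_Rad_hits[OF small, of n]
      show "AE \<omega> in Rad. \<exists>k\<ge>n. \<bar>YH \<sigma> H k \<omega>\<bar> \<le> gH \<sigma> H k"
      proof eventually_elim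
        case (elim \<omega>)
        then obtain k where "n \<le> k" "\<bar>YH \<sigma> H (Suc k) \<omega>\<bar> \<le> gH \<sigma> H (Suc k)"
          unfolding YH_eq_path_sum by (simp del: upt_Suc) blast
        then show ?case by (intro exI[of _ "Suc k"]) auto
      qed
    qed
    then have "AE \<omega> in Rad. \<not> (\<exists>n\<ge>1. \<forall>k\<ge>n. \<bar>YH \<sigma> H k \<omega>\<bar> > gH \<sigma> H k)"
      by eventually_elim (meson not_less)
    then show ?thesis by (subst Rad.prob_Collect_eq_0) measurable
  qed
  have AP: "(\<lambda>N. real (card (AP \<sigma> a H N)) / 2 ^ (N - 1)) \<longlonglongrightarrow> 1"
    if "1/2 < H" "H < 1" for H
    by (rule card_AP_fraction_tendsto_1[OF that assms(2) large[OF that order_refl]])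
  show ?thesis
    \<comment> \<open>Up to \<open>5/8\<close> the coefficients near the diagonal stay below
      \<open>gH\<close>, as \<open>ult\<close> requires.\<close>
    by (intro exI[of _ "5/8"] conjI allI impI io ult AP) simp_all
qed

end
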